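(* Let $d\ge 0$ and let $V_0,V_1,V_2$ be polarized degree $d$ Hilbert spaces. Let $r_{01}=(r_0,r_1)\colon\mathcal{H}_{01}\to\Pi V_0\oplus V_1$ and $r_{12}=(r_1',r_2)\colon\mathcal{H}_{12}\to\Pi V_1\oplus V_2$ be generalized Lagrangians whose images are split. Then their fiber product over $V_1$, $$\mathcal{H}_{12}\times_{V_1}\mathcal{H}_{01}=\{(\Phi_{01},\Phi_{12})\in\mathcal{H}_{01}\times\mathcal{H}_{12}\mid r_1(\Phi_{01})=r_1'(\Phi_{12})\},$$ together with the map $(\Phi_{01},\Phi_{12})\mapsto(r_0(\Phi_{01}),r_2(\Phi_{12}))\in\Pi V_0\oplus V_2$, is a generalized Lagrangian in $\Pi V_0\oplus V_2$ whose image is split.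
   Context: A super Hilbert space is a (real or complex) Hilbert space $V$ with an orthogonal decomposition $V=V^+\oplus V^-$; its grading operator $\Gamma$ is $\pm1$ on $V^\pm$, and $B(x,y)=\langle\Gamma x,y\rangle$. $\Pi V$ is the same Hilbert space with grading operator $-\Gamma$. Let $\mathrm{Cl}_d$ be the real Clifford algebra with anticommuting generators $e_1,\dots,e_d$, $e_j^2=-1$. A degree $d$ Hilbert space is a super Hilbert space that is also a graded right $\mathrm{Cl}_d$-module on which the $e_j$ act as odd, skew-adjoint operators; $\Pi V$ carries the same $\mathrm{Cl}_d$-action, and direct sums carry the diagonal action. A subspace is $B$-isotropic if $B$ vanishes on it. In a degree $d$ Hilbert space, a sub-Lagrangian is a closed, $\mathrm{Cl}_d$-invariant, $B$-isotropic subspace $L$ such that $L+\Gamma L$ has finite codimension; it is a Lagrangian if $L+\Gamma L=V$. Two closed subspaces are close if the difference of their orthogonal projections is Hilbert--Schmidt; this is an equivalence relation. A polarization is a closeness class $[L]$ of ($\mathrm{Cl}_d$-invariant) sub-Lagrangians. For $V_0,V_1$ polarized by $[L_0],[L_1]$, a Lagrangian in $\Pi V_0\oplus V_1$ is split if it is close to $L_0^\perp\oplus L_1$ for some (hence any) representatives $L_i$. A generalized Lagrangian in a degree $d$ Hilbert space $V$ is an (ungraded) $\mathrm{Cl}_d$-module $\mathcal{H}$ (no topology) with a $\mathrm{Cl}_d$-equivariant linear map $r\colon\mathcal{H}\to V$ such that $\mathrm{im}(r)$ is a Lagrangian in $V$ and $\ker(r)$ is finite-dimensional. *)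

theory Defs
  imports "HOL-Analysis.Analysis"
begin

text \<open>
  The scalar field of a Hilbert space is the type \<open>real\<close> or the type \<open>complex\<close>. Every normed field
  over the reals is isomorphic to one of the two (Gelfand--Mazur), so the following class
  contains no other fields, and its axioms determine \<open>conjg\<close>.
\<close>

class real_or_complex = real_normed_field +
  fixes conjg :: "'a \<Rightarrow> 'a"
  assumes conjg_add: "conjg (x + y) = conjg x + conjg y"
    and conjg_mult: "conjg (x * y) = conjg x * conjg y"
    and mult_conjg: "x * conjg x = (norm x)\<^sup>2 *\<^sub>R 1"

instantiation real :: real_or_complex
begin
definition conjg_real :: "real \<Rightarrow> real" where "conjg_real x = x"
instance by standard (simp_all add: conjg_real_def power2_eq_square)
end

instantiation complex :: real_or_complex
begin
definition conjg_complex :: "complex \<Rightarrow> complex" where "conjg_complex = cnj"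
instance
  by standard (simp_all add: conjg_complex_def complex_norm_square scaleR_conv_of_real flip: of_real_power)
end

record ('k, 'v) cl_space =
  scl :: "'k \<Rightarrow> 'v \<Rightarrow> 'v"
  cl :: "nat \<Rightarrow> 'v \<Rightarrow> 'v"

text \<open>
  \<open>cl M j\<close> is the action of the generator \<open>e\<^sub>j\<close>, meaningful for \<open>j \<in> {1..d}\<close>. As the Clifford
  algebra is given by generators and relations, a module over it is a family of linear operators
  satisfying the relations; these read the same for left and right modules.
\<close>

definition clifford_module ::
  "nat \<Rightarrow> ('k::field, 'v::ab_group_add, 'z) cl_space_scheme \<Rightarrow> bool" where
  "clifford_module d M \<longleftrightarrow>
     vector_space (scl M) \<and>
     (\<forall>j\<in>{1..d}. Vector_Spaces.linear (scl M) (scl M) (cl M j)) \<and>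
     (\<forall>j\<in>{1..d}. \<forall>x. cl M j (cl M j x) = - x) \<and>
     (\<forall>i\<in>{1..d}. \<forall>j\<in>{1..d}. i \<noteq> j \<longrightarrow> (\<forall>x. cl M i (cl M j x) = - cl M j (cl M i x)))"

definition clifford_submodule ::
  "nat \<Rightarrow> ('k::field, 'v::ab_group_add, 'z) cl_space_scheme \<Rightarrow> 'v set \<Rightarrow> bool" where
  "clifford_submodule d M S \<longleftrightarrow>
     module.subspace (scl M) S \<and> (\<forall>j\<in>{1..d}. \<forall>x\<in>S. cl M j x \<in> S)"

definition clifford_module_sum ::
  "('k, 'v) cl_space \<Rightarrow> ('k, 'w) cl_space \<Rightarrow> ('k, 'v \<times> 'w) cl_space" where
  "clifford_module_sum M N =
     \<lparr>scl = (\<lambda>c. map_prod (scl M c) (scl N c)), cl = (\<lambda>j. map_prod (cl M j) (cl N j))\<rparr>"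

definition finite_dimensional ::
  "('k::field, 'v::ab_group_add, 'z) cl_space_scheme \<Rightarrow> 'v set \<Rightarrow> bool" where
  "finite_dimensional M S \<longleftrightarrow> (\<exists>F. finite F \<and> module.span (scl M) F = S)"

definition finite_codimensional ::
  "('k::field, 'v::ab_group_add, 'z) cl_space_scheme \<Rightarrow> 'v set \<Rightarrow> bool" where
  "finite_codimensional M S \<longleftrightarrow> (\<exists>F. finite F \<and> module.span (scl M) (S \<union> F) = UNIV)"

record ('k, 'v) cl_hilbert = "('k, 'v) cl_space" +
  ip :: "'v \<Rightarrow> 'v \<Rightarrow> 'k"
  grading :: "'v \<Rightarrow> 'v"

text \<open>
  The scalar-valued inner product \<open>ip\<close> (linear in the first argument) induces the norm of the
  type, so that the topology and the completeness of the space are those of the type.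
\<close>

definition hilbert_space ::
  "('k::real_or_complex, 'v::{real_inner, complete_space}) cl_hilbert \<Rightarrow> bool" where
  "hilbert_space V \<longleftrightarrow>
     vector_space (scl V) \<and>
     (\<forall>a x. scl V (of_real a) x = a *\<^sub>R x) \<and>
     (\<forall>x y z. ip V (x + y) z = ip V x z + ip V y z) \<and>
     (\<forall>c x y. ip V (scl V c x) y = c * ip V x y) \<and>
     (\<forall>x y. ip V y x = conjg (ip V x y)) \<and>
     (\<forall>x. ip V x x = of_real ((norm x)\<^sup>2))"

definition super_hilbert_space ::
  "('k::real_or_complex, 'v::{real_inner, complete_space}) cl_hilbert \<Rightarrow> bool" where
  "super_hilbert_space V \<longleftrightarrow>
     hilbert_space V \<and>
     (\<exists>Vp Vm. module.subspace (scl V) Vp \<and> module.subspace (scl V) Vm \<and>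
        (\<forall>x\<in>Vp. \<forall>y\<in>Vm. ip V x y = 0) \<and>
        (\<forall>x. \<exists>u\<in>Vp. \<exists>v\<in>Vm. x = u + v) \<and>
        (\<forall>u\<in>Vp. \<forall>v\<in>Vm. grading V (u + v) = u - v))"

definition degree_hilbert_space ::
  "nat \<Rightarrow> ('k::real_or_complex, 'v::{real_inner, complete_space}) cl_hilbert \<Rightarrow> bool" where
  "degree_hilbert_space d V \<longleftrightarrow>
     super_hilbert_space V \<and> clifford_module d V \<and>
     (\<forall>j\<in>{1..d}. \<forall>x. cl V j (grading V x) = - grading V (cl V j x)) \<and>
     (\<forall>j\<in>{1..d}. \<forall>x y. ip V (cl V j x) y = - ip V x (cl V j y))"

definition bform :: "('k, 'v) cl_hilbert \<Rightarrow> 'v \<Rightarrow> 'v \<Rightarrow> 'k" where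
  "bform V x y = ip V (grading V x) y"

definition parity_flip :: "('k, 'v::ab_group_add) cl_hilbert \<Rightarrow> ('k, 'v) cl_hilbert" where
  "parity_flip V = V\<lparr>grading := (\<lambda>x. - grading V x)\<rparr>"

definition hilbert_sum ::
  "('k::plus, 'v) cl_hilbert \<Rightarrow> ('k, 'w) cl_hilbert \<Rightarrow> ('k, 'v \<times> 'w) cl_hilbert" where
  "hilbert_sum V W =
     \<lparr>scl = (\<lambda>c. map_prod (scl V c) (scl W c)),
      cl = (\<lambda>j. map_prod (cl V j) (cl W j)),
      ip = (\<lambda>x y. ip V (fst x) (fst y) + ip W (snd x) (snd y)),
      grading = map_prod (grading V) (grading W)\<rparr>"

definition closed_subspace ::
  "('k::real_or_complex, 'v::{real_inner, complete_space}) cl_hilbert \<Rightarrow> 'v set \<Rightarrow> bool" where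
  "closed_subspace V L \<longleftrightarrow> module.subspace (scl V) L \<and> closed L"

definition isotropic :: "('k::zero, 'v) cl_hilbert \<Rightarrow> 'v set \<Rightarrow> bool" where
  "isotropic V L \<longleftrightarrow> (\<forall>x\<in>L. \<forall>y\<in>L. bform V x y = 0)"

definition plus_grading :: "('k, 'v::plus) cl_hilbert \<Rightarrow> 'v set \<Rightarrow> 'v set" where
  "plus_grading V L = {x + grading V y | x y. x \<in> L \<and> y \<in> L}"

definition sub_lagrangian ::
  "nat \<Rightarrow> ('k::real_or_complex, 'v::{real_inner, complete_space}) cl_hilbert \<Rightarrow> 'v set \<Rightarrow> bool"
  where
  "sub_lagrangian d V L \<longleftrightarrow>
     closed_subspace V L \<and> clifford_submodule d V L \<and> isotropic V L \<and>
     finite_codimensional V (plus_grading V L)"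

definition lagrangian ::
  "nat \<Rightarrow> ('k::real_or_complex, 'v::{real_inner, complete_space}) cl_hilbert \<Rightarrow> 'v set \<Rightarrow> bool"
  where
  "lagrangian d V L \<longleftrightarrow> sub_lagrangian d V L \<and> plus_grading V L = UNIV"

definition ortho_compl :: "('k::zero, 'v) cl_hilbert \<Rightarrow> 'v set \<Rightarrow> 'v set" where
  "ortho_compl V L = {x. \<forall>y\<in>L. ip V x y = 0}"

definition ortho_proj :: "('k::zero, 'v::minus) cl_hilbert \<Rightarrow> 'v set \<Rightarrow> 'v \<Rightarrow> 'v" where
  "ortho_proj V L x = (THE p. p \<in> L \<and> x - p \<in> ortho_compl V L)"

definition orthonormal_basis ::
  "('k::real_or_complex, 'v::{real_inner, complete_space}) cl_hilbert \<Rightarrow> 'v set \<Rightarrow> bool" where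
  "orthonormal_basis V E \<longleftrightarrow>
     (\<forall>x\<in>E. \<forall>y\<in>E. ip V x y = (if x = y then 1 else 0)) \<and>
     closure (module.span (scl V) E) = UNIV"

definition hilbert_schmidt ::
  "('k::real_or_complex, 'v::{real_inner, complete_space}) cl_hilbert \<Rightarrow> ('v \<Rightarrow> 'v) \<Rightarrow> bool" where
  "hilbert_schmidt V T \<longleftrightarrow>
     Vector_Spaces.linear (scl V) (scl V) T \<and> bounded_linear T \<and>
     (\<exists>E. orthonormal_basis V E \<and> (\<lambda>e. (norm (T e))\<^sup>2) summable_on E)"

definition close ::
  "('k::real_or_complex, 'v::{real_inner, complete_space}) cl_hilbert \<Rightarrow> 'v set \<Rightarrow> 'v set \<Rightarrow> bool"
  where
  "close V A B \<longleftrightarrow>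
     closed_subspace V A \<and> closed_subspace V B \<and>
     hilbert_schmidt V (\<lambda>x. ortho_proj V A x - ortho_proj V B x)"

definition polarization ::
  "nat \<Rightarrow> ('k::real_or_complex, 'v::{real_inner, complete_space}) cl_hilbert \<Rightarrow>
   'v set set \<Rightarrow> bool" where
  "polarization d V P \<longleftrightarrow>
     (\<exists>L. sub_lagrangian d V L \<and> P = {L'. sub_lagrangian d V L' \<and> close V L L'})"

definition polarized_hilbert_space ::
  "nat \<Rightarrow> ('k::real_or_complex, 'v::{real_inner, complete_space}) cl_hilbert \<Rightarrow>
   'v set set \<Rightarrow> bool" where
  "polarized_hilbert_space d V P \<longleftrightarrow> degree_hilbert_space d V \<and> polarization d V P"

definition split_lagrangian ::
  "nat \<Rightarrow> ('k::real_or_complex, 'v::{real_inner, complete_space}) cl_hilbert \<Rightarrow> 'v set set \<Rightarrow>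
   ('k, 'w::{real_inner, complete_space}) cl_hilbert \<Rightarrow> 'w set set \<Rightarrow> ('v \<times> 'w) set \<Rightarrow> bool"
  where
  "split_lagrangian d V0 P0 V1 P1 L \<longleftrightarrow>
     lagrangian d (hilbert_sum (parity_flip V0) V1) L \<and>
     (\<exists>L0\<in>P0. \<exists>L1\<in>P1. close (hilbert_sum (parity_flip V0) V1) L (ortho_compl V0 L0 \<times> L1))"

text \<open>
  The module is the submodule \<open>H\<close> of \<open>M\<close>; a module that is a whole type is the case \<open>H = UNIV\<close>.
  The map \<open>r\<close> is only relevant on \<open>H\<close>.
\<close>

definition generalized_lagrangian ::
  "nat \<Rightarrow> ('k::real_or_complex, 'v::{real_inner, complete_space}) cl_hilbert \<Rightarrow>
   ('k, 'h::ab_group_add) cl_space \<Rightarrow> 'h set \<Rightarrow> ('h \<Rightarrow> 'v) \<Rightarrow> bool" where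
  "generalized_lagrangian d V M H r \<longleftrightarrow>
     clifford_module d M \<and> clifford_submodule d M H \<and>
     (\<forall>x\<in>H. \<forall>y\<in>H. r (x + y) = r x + r y) \<and>
     (\<forall>c. \<forall>x\<in>H. r (scl M c x) = scl V c (r x)) \<and>
     (\<forall>j\<in>{1..d}. \<forall>x\<in>H. r (cl M j x) = cl V j (r x)) \<and>
     lagrangian d V (r ` H) \<and>
     finite_dimensional M {x\<in>H. r x = 0}"

definition fiber_product ::
  "'g set \<Rightarrow> 'h set \<Rightarrow> ('g \<Rightarrow> 'v) \<Rightarrow> ('h \<Rightarrow> 'v) \<Rightarrow> ('g \<times> 'h) set" where
  "fiber_product G H f g = {(x, y). x \<in> G \<and> y \<in> H \<and> f x = g y}"

end

theory Submission
  imports Defs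
begin

text \<open>
  Every closed subspace over the scalar field is a closed real subspace with the same orthogonal
  complement and projection, so the analysis takes place in real Hilbert spaces. On
  \<open>L\<^sub>0\<^sub>1 \<times> L\<^sub>1\<^sub>2\<close> consider \<open>D ((a, b), (b', c)) = ((a, c), b - b')\<close>. Up to Hilbert--Schmidt
  errors \<open>b\<close> lies in \<open>L\<^sub>1\<close> and \<open>b'\<close> in its orthogonal complement, so \<open>b\<close> and \<open>b'\<close> are controlled
  by \<open>b - b'\<close>: hence \<open>D\<close> has finite-dimensional kernel and closed range. The kernel bounds the
  kernel of the fiber product. The closed range makes the orthogonal complement of
  \<open>{b = b'}\<close> in \<open>L\<^sub>0\<^sub>1 \<times> L\<^sub>1\<^sub>2\<close> a sum of two complements, which gives maximality of the composite.
  Finally \<open>D\<close> is bounded below modulo its kernel, so a point of the composite lifts with control to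
  the fiber product, which shows that the composite is near \<open>L\<^sub>0\<^sup>\<bottom> \<times> L\<^sub>2\<close>; the converse estimate
  follows by applying the grading.
\<close>

section \<open>Orthogonal projections\<close>

text \<open>Two things go wrong for general closed relations in infinite dimensions: their composite
  need not be closed, and the complement of an intersection is only the closure of the sum of the
  complements. Splitness cures both through one a priori estimate, |x| \<le> 6 (|Dx| + |Kx|), whose
  remainder \<open>K\<close> is Hilbert--Schmidt on the product of the two Lagrangians. The same
  estimate, restricted to the points with equal middle entries, makes the composite closed. The
  reason behind the converse estimate: let P and Q be the projections onto the composite and onto
  the model Y. Maximality of the composite gives 1 - P = G P G for the grading G of the sum, so (1 -
  P) y = G P (G y) for y in Y. The part of G y off Y is handled by P (1 - Q), the adjoint of the
  direct estimate (1 - Q) P. The part of G y in Y is small because G nearly exchanges Y with its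
  complement: this is isotropy for the last factor, and finite codimension of the sub-Lagrangian
  plus its graded image for the first.\<close>

definition proj :: "'a::real_inner set \<Rightarrow> 'a \<Rightarrow> 'a" where
  "proj L x = (THE p. p \<in> L \<and> x - p \<in> orthogonal_comp L)"

lemma orthogonal_comp_iff: "x \<in> orthogonal_comp L \<longleftrightarrow> (\<forall>y\<in>L. inner x y = 0)"
  by (auto simp: orthogonal_comp_def orthogonal_def inner_commute)

lemma closed_orthogonal_comp: "closed (orthogonal_comp L)"
proof -
  have eq: "orthogonal_comp L = (\<Inter>y\<in>L. {x. inner y x = 0})"
    by (auto simp: orthogonal_comp_def orthogonal_def)
  show ?thesis
    unfolding eq by (intro closed_INT ballI closed_Collect_eq continuous_intros)
qed

text \<open>By the parallelogram law, points of \<open>L\<close> that nearly realize the distance to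
  \<open>x\<close> are near each other, so a minimizing sequence is Cauchy. Its limit realizes the
  distance, and varying the minimizer inside \<open>L\<close> gives orthogonality.\<close>

lemma ex_projection:
  fixes L :: "'a::{real_inner, complete_space} set"
  assumes L: "subspace L" and cl: "closed L"
  shows "\<exists>p. p \<in> L \<and> x - p \<in> orthogonal_comp L"
proof -
  define d where "d = infdist x L"
  have ne: "L \<noteq> {}" using subspace_0[OF L] by auto
  have d_le: "d \<le> norm (x - y)" if "y \<in> L" for y
    using infdist_le[OF that, of x] by (simp add: d_def dist_norm)
  have d0: "d \<ge> 0" by (simp add: d_def infdist_nonneg)
  have "\<exists>y\<in>L. dist x y < d + inverse (real (Suc n))" for n
    using cInf_lessD[of "dist x ` L" "d + inverse (real (Suc n))"] ne
    by (auto simp: d_def infdist_notempty)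
  then obtain y where yL: "\<And>n. y n \<in> L" and y: "\<And>n. norm (x - y n) < d + inverse (real (Suc n))"
    by (metis dist_norm)
  have diff: "(norm (y n - y m))\<^sup>2 \<le> (8 * d + 4) * inverse (real (Suc N))" if "n \<ge> N" "m \<ge> N" for n m N
  proof -
    define b where "b = inverse (real (Suc N))"
    have b: "0 < b" "b \<le> 1" by (auto simp: b_def divide_simps)
    have le: "(norm (x - y k))\<^sup>2 \<le> (d + b)\<^sup>2" if "k \<ge> N" for k
    proof -
      have "norm (x - y k) \<le> d + b"
        using y[of k] that by (smt (verit) b_def inverse_eq_divide frac_le of_nat_mono Suc_le_mono of_nat_0_less_iff zero_less_Suc)
      then show ?thesis by (simp add: power_mono)
    qed
    \<comment> \<open>The midpoint is again at distance at least \<open>d\<close>, which bounds the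
      subtracted term of the parallelogram law; \<open>b \<le> 1\<close> then makes the estimate
      linear in \<open>b\<close>.\<close>
    have mid: "(1/2) *\<^sub>R (y n + y m) \<in> L"
      by (intro subspace_scale subspace_add L yL)
    have "(norm (y n - y m))\<^sup>2 = 2 * (norm (x - y n))\<^sup>2 + 2 * (norm (x - y m))\<^sup>2
        - 4 * (norm (x - (1/2) *\<^sub>R (y n + y m)))\<^sup>2"
      by (simp add: power2_norm_eq_inner algebra_simps inner_commute)
    also have "\<dots> \<le> 4 * (d + b)\<^sup>2 - 4 * d\<^sup>2"
      using le[OF that(1)] le[OF that(2)] power_mono[OF d_le[OF mid] d0, of 2] by linarith
    also have "\<dots> = 8 * d * b + 4 * (b * b)" by (simp add: power2_eq_square algebra_simps)
    also have "\<dots> \<le> (8 * d + 4) * b" using b by (simp add: algebra_simps)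
    finally show ?thesis by (simp add: b_def)
  qed
  have "Cauchy y"
  proof (rule metric_CauchyI)
    fix e :: real assume e: "e > 0"
    obtain N where N: "inverse (real (Suc N)) < e\<^sup>2 / (8 * d + 4)"
      using reals_Archimedean[of "e\<^sup>2 / (8 * d + 4)"] e d0 by auto
    have "(8 * d + 4) * inverse (real (Suc N)) < e\<^sup>2"
      using N d0 by (subst (asm) pos_less_divide_eq) (auto simp: mult.commute)
    then have "norm (y m - y n) < e" if "m \<ge> N" "n \<ge> N" for m n
      using diff[OF that] e power_less_imp_less_base[of "norm (y m - y n)" 2 e] by linarith
    then show "\<exists>M. \<forall>m\<ge>M. \<forall>n\<ge>M. dist (y m) (y n) < e"
      by (auto simp: dist_norm)
  qed
  then obtain p where p: "y \<longlonglongrightarrow> p" using convergent_eq_Cauchy by blast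
  have pL: "p \<in> L" using closed_sequentially[OF cl yL p] .
  have "(\<lambda>n. d + inverse (real (Suc n))) \<longlonglongrightarrow> d + 0"
    by (intro tendsto_intros LIMSEQ_inverse_real_of_nat)
  moreover have "(\<lambda>n. norm (x - y n)) \<longlonglongrightarrow> norm (x - p)" by (intro tendsto_intros p)
  ultimately have "norm (x - p) \<le> d + 0"
    using y by (intro LIMSEQ_le) (auto intro: less_imp_le)
  then have min: "norm (x - p) \<le> norm (x - z)" if "z \<in> L" for z
    using d_le[OF that] by linarith
  have "inner (x - p) z = 0" if z: "z \<in> L" for z
  proof (cases "z = 0")
    case False
    \<comment> \<open>The minimum of the quadratic function |x - p - t z|^2 of
      \<open>t\<close>.\<close>
    define t where "t = inner (x - p) z / (norm z)\<^sup>2"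
    have "p + t *\<^sub>R z \<in> L" by (intro subspace_add subspace_scale L pL z)
    from power_mono[OF min[OF this], of 2]
    have "(norm (x - p))\<^sup>2 \<le> (norm (x - p - t *\<^sub>R z))\<^sup>2" by (simp add: diff_diff_eq)
    also have "\<dots> = (norm (x - p))\<^sup>2 - 2 * t * inner (x - p) z + t * t * (norm z)\<^sup>2"
      by (simp add: power2_norm_eq_inner algebra_simps inner_commute)
    also have "t * t * (norm z)\<^sup>2 = t * inner (x - p) z"
      using False by (simp add: t_def power2_eq_square)
    finally have "t * inner (x - p) z \<le> 0" by simp
    then have "(inner (x - p) z)\<^sup>2 \<le> 0" 
      using False by (simp add: t_def power2_eq_square divide_simps zero_less_mult_iff split: if_splits)
    then show ?thesis by simp
  qed auto
  then show ?thesis using pL by (auto simp: orthogonal_comp_iff)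
qed

lemma proj_eqI:
  assumes L: "subspace L" and p: "p \<in> L" and o: "x - p \<in> orthogonal_comp L"
  shows "proj L x = p"
  unfolding proj_def
proof (rule the_equality)
  fix q assume q: "q \<in> L \<and> x - q \<in> orthogonal_comp L"
  have qp: "q - p \<in> L" using q p L subspace_diff by blast
  have "inner (q - p) (q - p) = inner (x - p) (q - p) - inner (x - q) (q - p)"
    by (simp add: algebra_simps)
  also have "\<dots> = 0" using q o qp by (auto simp: orthogonal_comp_iff)
  finally show "q = p" by simp
qed (use p o in auto)

locale closed_sub =
  fixes L :: "'a::{real_inner, complete_space} set"
  assumes subspace: "subspace L" and closed: "closed L"
begin

lemma proj_in: "proj L x \<in> L" and diff_proj_in: "x - proj L x \<in> orthogonal_comp L"
  using ex_projection[OF subspace closed] proj_eqI[OF subspace] by metis+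

lemma inner_diff_proj: "y \<in> L \<Longrightarrow> inner (x - proj L x) y = 0"
  using diff_proj_in orthogonal_comp_iff by blast

lemma proj_eq: "p \<in> L \<Longrightarrow> (\<And>y. y \<in> L \<Longrightarrow> inner (x - p) y = 0) \<Longrightarrow> proj L x = p"
  by (rule proj_eqI[OF subspace]) (auto simp: orthogonal_comp_iff)

lemma proj_ident: "x \<in> L \<Longrightarrow> proj L x = x"
  by (rule proj_eq) auto

lemma proj_orthogonal: "x \<in> orthogonal_comp L \<Longrightarrow> proj L x = 0"
  by (rule proj_eq) (auto simp: orthogonal_comp_iff subspace_0[OF subspace])

lemma inner_proj_left: "inner (proj L x) y = inner (proj L x) (proj L y)"
  using inner_diff_proj[OF proj_in, of y x] by (simp add: inner_commute algebra_simps)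

lemma inner_proj: "inner (proj L x) y = inner x (proj L y)"
  by (metis inner_proj_left inner_commute)

lemma norm_proj_split: "(norm x)\<^sup>2 = (norm (proj L x))\<^sup>2 + (norm (x - proj L x))\<^sup>2"
  using inner_diff_proj[OF proj_in, of x x]
  by (simp add: power2_norm_eq_inner algebra_simps inner_commute)

lemma norm_proj_le: "norm (proj L x) \<le> norm x"
  using norm_proj_split[of x] by (simp add: power2_le_imp_le)

lemma linear_proj: "linear (proj L)"
proof (rule linearI)
  show "proj L (x + y) = proj L x + proj L y" for x y
  proof (rule proj_eq)
    show "inner (x + y - (proj L x + proj L y)) z = 0" if "z \<in> L" for z
      using inner_diff_proj[OF that, of x] inner_diff_proj[OF that, of y] by (simp add: algebra_simps)
  qed (intro subspace_add subspace proj_in)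
  show "proj L (c *\<^sub>R x) = c *\<^sub>R proj L x" for c x
  proof (rule proj_eq)
    show "inner (c *\<^sub>R x - c *\<^sub>R proj L x) z = 0" if "z \<in> L" for z
      using inner_diff_proj[OF that, of x] by (simp flip: scaleR_diff_right)
  qed (intro subspace_scale subspace proj_in)
qed

lemma bounded_linear_proj: "bounded_linear (proj L)"
  using linear_proj norm_proj_le
  by (auto intro!: bounded_linear_intro[where K = 1] simp: linear_add linear_scale)

lemma bounded_linear_diff_proj: "bounded_linear (\<lambda>x. x - proj L x)"
  by (intro bounded_linear_sub bounded_linear_ident bounded_linear_proj)

lemma orthogonal_comp_twice: "orthogonal_comp (orthogonal_comp L) = L"
proof
  show "orthogonal_comp (orthogonal_comp L) \<subseteq> L"
  proof
    fix x assume x: "x \<in> orthogonal_comp (orthogonal_comp L)"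
    have "inner (x - proj L x) (x - proj L x) = inner x (x - proj L x) - inner (x - proj L x) (proj L x)"
      by (simp add: inner_commute algebra_simps)
    also have "\<dots> = 0" using x diff_proj_in inner_diff_proj[OF proj_in] by (auto simp: orthogonal_comp_iff)
    finally show "x \<in> L" using proj_in[of x] by simp
  qed
qed (auto simp: orthogonal_comp_def orthogonal_def inner_commute)

lemma proj_orthogonal_comp: "proj (orthogonal_comp L) x = x - proj L x"
  by (rule proj_eqI[OF subspace_orthogonal_comp diff_proj_in])
     (simp add: orthogonal_comp_twice proj_in)

end

lemma closed_sub_orthogonal_comp: "closed_sub (orthogonal_comp L)"
  by (simp add: closed_orthogonal_comp closed_sub.intro subspace_orthogonal_comp)

lemma closed_sub_Times: "closed_sub A \<Longrightarrow> closed_sub B \<Longrightarrow> closed_sub (A \<times> B)"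
  by (simp add: closed_sub_def subspace_Times closed_Times)

lemma proj_Times:
  assumes "closed_sub A" "closed_sub B"
  shows "proj (A \<times> B) x = (proj A (fst x), proj B (snd x))"
  by (rule closed_sub.proj_eq[OF closed_sub_Times[OF assms]])
     (auto simp: inner_prod_def closed_sub.proj_in closed_sub.inner_diff_proj assms)

lemma closed_sub_Int: "closed_sub A \<Longrightarrow> closed_sub B \<Longrightarrow> closed_sub (A \<inter> B)"
  by (simp add: closed_sub_def subspace_inter closed_Int)

section \<open>Hilbert--Schmidt maps\<close>

text \<open>
  Testing on families bounded by orthonormal ones, instead of on a basis, needs no existence of
  bases and makes precomposition with maps bounded only on a subspace immediate.
\<close>

definition bessel :: "nat \<Rightarrow> (nat \<Rightarrow> 'a::real_inner) \<Rightarrow> bool" where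
  "bessel n x \<longleftrightarrow> (\<forall>c. (norm (\<Sum>i<n. c i *\<^sub>R x i))\<^sup>2 \<le> (\<Sum>i<n. (c i)\<^sup>2))"

definition hs_on :: "'a::real_inner set \<Rightarrow> ('a \<Rightarrow> 'b::real_inner) \<Rightarrow> bool" where
  "hs_on A T \<longleftrightarrow>
     (\<exists>C. \<forall>n x. bessel n x \<and> x ` {..<n} \<subseteq> A \<longrightarrow> (\<Sum>i<n. (norm (T (x i)))\<^sup>2) \<le> C)"

definition orthonormal :: "'a::real_inner set \<Rightarrow> bool" where
  "orthonormal G \<longleftrightarrow> pairwise orthogonal G \<and> (\<forall>g\<in>G. norm g = 1)"

text \<open>Duality: the synthesis map of a Bessel family is a contraction, hence so is its adjoint.
  Concretely, Cauchy--Schwarz with the coefficients \<open>inner (x i) w\<close> bounds the square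
  of \<open>s\<close> by \<open>s\<close> times the squared norm of \<open>w\<close>.\<close>

lemma bessel_inner_le:
  assumes "bessel n x"
  shows "(\<Sum>i<n. (inner (x i) w)\<^sup>2) \<le> (norm w)\<^sup>2"
proof -
  define s where "s = (\<Sum>i<n. (inner (x i) w)\<^sup>2)"
  have s0: "s \<ge> 0" by (simp add: s_def sum_nonneg)
  have "s = inner (\<Sum>i<n. inner (x i) w *\<^sub>R x i) w"
    by (simp add: s_def inner_sum_left power2_eq_square)
  then have "s\<^sup>2 \<le> (norm (\<Sum>i<n. inner (x i) w *\<^sub>R x i))\<^sup>2 * (norm w)\<^sup>2"
    by (metis Cauchy_Schwarz_ineq power2_norm_eq_inner)
  also have "\<dots> \<le> s * (norm w)\<^sup>2"
    using assms by (intro mult_right_mono) (auto simp: bessel_def s_def)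
  finally have "s * s \<le> s * (norm w)\<^sup>2" by (simp add: power2_eq_square)
  then show ?thesis using s0 unfolding s_def[symmetric]
    by (cases "s = 0") (auto simp: mult_le_cancel_left)
qed

text \<open>Only norms of finite combinations are compared, so \<open>y\<close> may be a family
  chosen point by point, such as a family of lifts.\<close>

lemma bessel_scaled:
  assumes "bessel n x" "M > 0"
    and "\<And>c. norm (\<Sum>i<n. c i *\<^sub>R y i) \<le> M * norm (\<Sum>i<n. c i *\<^sub>R x i)"
  shows "bessel n (\<lambda>i. (1 / M) *\<^sub>R y i)"
  unfolding bessel_def
proof
  fix c :: "nat \<Rightarrow> real"
  have "(\<Sum>i<n. c i *\<^sub>R (1 / M) *\<^sub>R y i) = (1 / M) *\<^sub>R (\<Sum>i<n. c i *\<^sub>R y i)"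
    by (simp add: scaleR_sum_right mult.commute)
  then have "norm (\<Sum>i<n. c i *\<^sub>R (1 / M) *\<^sub>R y i) \<le> norm (\<Sum>i<n. c i *\<^sub>R x i)"
    using assms(3)[of c] assms(2) by (simp add: field_simps)
  then have "(norm (\<Sum>i<n. c i *\<^sub>R (1 / M) *\<^sub>R y i))\<^sup>2 \<le> (norm (\<Sum>i<n. c i *\<^sub>R x i))\<^sup>2"
    by (simp add: power_mono)
  also have "\<dots> \<le> (\<Sum>i<n. (c i)\<^sup>2)" using assms(1) by (simp add: bessel_def)
  finally show "(norm (\<Sum>i<n. c i *\<^sub>R (1 / M) *\<^sub>R y i))\<^sup>2 \<le> (\<Sum>i<n. (c i)\<^sup>2)" .
qed

section \<open>Finite orthonormal sets as Bessel families\<close>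

lemma orthonormal_inner: "orthonormal G \<Longrightarrow> g \<in> G \<Longrightarrow> h \<in> G \<Longrightarrow> inner g h = (if g = h then 1 else 0)"
  by (auto simp: orthonormal_def pairwise_def orthogonal_def norm_eq_1)

lemma orthonormal_inner_sum:
  assumes "finite G" "orthonormal G" "h \<in> G"
  shows "inner (\<Sum>g\<in>G. c g *\<^sub>R g) h = c h"
proof -
  have "inner (\<Sum>g\<in>G. c g *\<^sub>R g) h = (\<Sum>g\<in>G. if g = h then c g else 0)"
    unfolding inner_sum_left
    by (rule sum.cong[OF refl]) (use assms in \<open>simp add: orthonormal_inner\<close>)
  also have "\<dots> = c h" using assms by simp
  finally show ?thesis .
qed

lemma orthonormal_norm_sum:
  assumes "finite G" "orthonormal G"
  shows "(norm (\<Sum>g\<in>G. c g *\<^sub>R g))\<^sup>2 = (\<Sum>g\<in>G. (c g)\<^sup>2)"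
proof -
  have "(norm (\<Sum>g\<in>G. c g *\<^sub>R g))\<^sup>2 = (\<Sum>h\<in>G. c h * inner (\<Sum>g\<in>G. c g *\<^sub>R g) h)"
    by (simp add: power2_norm_eq_inner inner_sum_right)
  also have "\<dots> = (\<Sum>g\<in>G. (c g)\<^sup>2)"
    using orthonormal_inner_sum[OF assms] by (simp add: power2_eq_square)
  finally show ?thesis .
qed

lemma orthonormal_norm_span:
  assumes G: "finite G" "orthonormal G" and v: "v \<in> span G"
  shows "(norm v)\<^sup>2 = (\<Sum>g\<in>G. (inner v g)\<^sup>2)"
proof -
  obtain u where u: "v = (\<Sum>g\<in>G. u g *\<^sub>R g)" using v G by (auto simp: span_finite)
  show ?thesis unfolding u orthonormal_norm_sum[OF G] using orthonormal_inner_sum[OF G] by simp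
qed

lemma orthonormal_bessel:
  assumes G: "finite G" "orthonormal G"
  obtains h where "bij_betw h {..<card G} G" "bessel (card G) h"
proof -
  obtain h where h: "bij_betw h {..<card G} G"
    using ex_bij_betw_nat_finite[OF G(1)] by (auto simp: atLeast0LessThan)
  define k where "k = the_inv_into {..<card G} h"
  have k: "k (h i) = i" if "i < card G" for i
    using that h unfolding k_def bij_betw_def by (simp add: the_inv_into_f_f)
  have "(norm (\<Sum>i<card G. c i *\<^sub>R h i))\<^sup>2 = (\<Sum>i<card G. (c i)\<^sup>2)" for c
  proof -
    have "(\<Sum>i<card G. c i *\<^sub>R h i) = (\<Sum>g\<in>G. c (k g) *\<^sub>R g)"
      using sum.reindex_bij_betw[OF h, of "\<lambda>g. c (k g) *\<^sub>R g"] k by simp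
    moreover have "(\<Sum>i<card G. (c i)\<^sup>2) = (\<Sum>g\<in>G. (c (k g))\<^sup>2)"
      using sum.reindex_bij_betw[OF h, of "\<lambda>g. (c (k g))\<^sup>2"] k by simp
    ultimately show ?thesis using orthonormal_norm_sum[OF G] by simp
  qed
  then show thesis using that h by (simp add: bessel_def)
qed

lemma orthonormal_inner_le:
  assumes G: "finite G" "orthonormal G"
  shows "(\<Sum>g\<in>G. (inner v g)\<^sup>2) \<le> (norm v)\<^sup>2"
proof -
  obtain h where h: "bij_betw h {..<card G} G" "bessel (card G) h"
    using orthonormal_bessel[OF G] .
  show ?thesis
    using bessel_inner_le[OF h(2), of v] sum.reindex_bij_betw[OF h(1), of "\<lambda>g. (inner v g)\<^sup>2"]
    by (simp add: inner_commute)
qed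

text \<open>Gram--Schmidt may leave the zero vector in the orthogonal set; it is dropped before
  normalizing.\<close>

lemma ex_orthonormal_span:
  fixes F :: "'a::real_inner set"
  assumes "finite F"
  obtains G where "finite G" "orthonormal G" "span G = span F"
proof -
  obtain C where C: "finite C" "span C = span F" "pairwise orthogonal C"
    using basis_orthogonal[OF assms] by blast
  define G where "G = (\<lambda>x. (1 / norm x) *\<^sub>R x) ` (C - {0})"
  have "span G = span (C - {0})"
    unfolding G_def using C by (intro span_image_scale) auto
  then have "span G = span F" using C by simp
  moreover have "pairwise orthogonal G"
    using C(3) unfolding G_def pairwise_def by (auto simp: orthogonal_def)
  ultimately show thesis
    using that[of G] C by (auto simp: G_def orthonormal_def)
qed

lemma hs_on_orthonormal:
  assumes "hs_on A T"
  obtains C where "\<And>G. finite G \<Longrightarrow> orthonormal G \<Longrightarrow> G \<subseteq> A \<Longrightarrow> (\<Sum>g\<in>G. (norm (T g))\<^sup>2) \<le> C"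
proof -
  obtain C where C: "\<And>n x. bessel n x \<Longrightarrow> x ` {..<n} \<subseteq> A \<Longrightarrow> (\<Sum>i<n. (norm (T (x i)))\<^sup>2) \<le> C"
    using assms unfolding hs_on_def by blast
  have "(\<Sum>g\<in>G. (norm (T g))\<^sup>2) \<le> C" if G: "finite G" "orthonormal G" "G \<subseteq> A" for G
  proof -
    obtain h where h: "bij_betw h {..<card G} G" "bessel (card G) h"
      using orthonormal_bessel[OF G(1,2)] .
    show ?thesis
      using C[OF h(2)] sum.reindex_bij_betw[OF h(1), of "\<lambda>g. (norm (T g))\<^sup>2"] G(3) h(1)
      by (auto simp: bij_betw_def)
  qed
  then show thesis using that by blast
qed

section \<open>Closure properties of Hilbert--Schmidt maps\<close>

lemma hs_on_subset: "hs_on A T \<Longrightarrow> A' \<subseteq> A \<Longrightarrow> hs_on A' T"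
  unfolding hs_on_def by (meson order_trans)

lemma hs_on_dominated:
  assumes "hs_on A T" and dom: "\<And>x. x \<in> A \<Longrightarrow> norm (S x) \<le> M * norm (T x)"
  shows "hs_on A S"
proof -
  obtain C where C: "\<And>n x. bessel n x \<Longrightarrow> x ` {..<n} \<subseteq> A \<Longrightarrow> (\<Sum>i<n. (norm (T (x i)))\<^sup>2) \<le> C"
    using assms unfolding hs_on_def by blast
  have "(\<Sum>i<n. (norm (S (x i)))\<^sup>2) \<le> M\<^sup>2 * C" if "bessel n x" "x ` {..<n} \<subseteq> A" for n x
  proof -
    have "(norm (S (x i)))\<^sup>2 \<le> M\<^sup>2 * (norm (T (x i)))\<^sup>2" if "i < n" for i
      using power_mono[OF dom[of "x i"] norm_ge_zero, of 2] that \<open>x ` {..<n} \<subseteq> A\<close>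
      by (auto simp: power_mult_distrib)
    then have "(\<Sum>i<n. (norm (S (x i)))\<^sup>2) \<le> (\<Sum>i<n. M\<^sup>2 * (norm (T (x i)))\<^sup>2)"
      by (intro sum_mono) auto
    also have "\<dots> = M\<^sup>2 * (\<Sum>i<n. (norm (T (x i)))\<^sup>2)" by (simp add: sum_distrib_left)
    also have "\<dots> \<le> M\<^sup>2 * C" using C[OF that] by (simp add: mult_left_mono)
    finally show ?thesis .
  qed
  then show ?thesis unfolding hs_on_def by blast
qed

lemma hs_on_cong: "hs_on A T \<Longrightarrow> (\<And>x. x \<in> A \<Longrightarrow> S x = T x) \<Longrightarrow> hs_on A S"
  by (rule hs_on_dominated[where M = 1]) auto

lemma hs_on_bounded_linear_left: "hs_on A T \<Longrightarrow> bounded_linear B \<Longrightarrow> hs_on A (\<lambda>x. B (T x))"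
  by (metis hs_on_dominated bounded_linear.bounded mult.commute)

lemma hs_on_add:
  assumes "hs_on A S" "hs_on A T"
  shows "hs_on A (\<lambda>x. S x + T x)"
proof -
  obtain C where C: "\<And>n x. bessel n x \<Longrightarrow> x ` {..<n} \<subseteq> A \<Longrightarrow> (\<Sum>i<n. (norm (T (x i)))\<^sup>2) \<le> C"
    using assms unfolding hs_on_def by blast
  obtain B where B: "\<And>n x. bessel n x \<Longrightarrow> x ` {..<n} \<subseteq> A \<Longrightarrow> (\<Sum>i<n. (norm (S (x i)))\<^sup>2) \<le> B"
    using assms unfolding hs_on_def by blast
  have le: "(norm (a + b))\<^sup>2 \<le> 2 * (norm a)\<^sup>2 + 2 * (norm b)\<^sup>2" for a b :: 'b
    using zero_le_power2[of "norm (a - b)"]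
    by (simp add: power2_norm_eq_inner algebra_simps inner_commute)
  have "(\<Sum>i<n. (norm (S (x i) + T (x i)))\<^sup>2) \<le> 2 * B + 2 * C"
    if "bessel n x" "x ` {..<n} \<subseteq> A" for n x
  proof -
    have "(\<Sum>i<n. (norm (S (x i) + T (x i)))\<^sup>2)
        \<le> (\<Sum>i<n. 2 * (norm (S (x i)))\<^sup>2 + 2 * (norm (T (x i)))\<^sup>2)"
      by (intro sum_mono le)
    also have "\<dots> = 2 * (\<Sum>i<n. (norm (S (x i)))\<^sup>2) + 2 * (\<Sum>i<n. (norm (T (x i)))\<^sup>2)"
      by (simp add: sum.distrib sum_distrib_left)
    also have "\<dots> \<le> 2 * B + 2 * C" using B[OF that] C[OF that] by simp
    finally show ?thesis .
  qed
  then show ?thesis unfolding hs_on_def by blast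
qed

lemma hs_on_minus: "hs_on A T \<Longrightarrow> hs_on A (\<lambda>x. - T x)"
  by (rule hs_on_dominated[where M = 1]) auto

lemma hs_on_diff: "hs_on A S \<Longrightarrow> hs_on A T \<Longrightarrow> hs_on A (\<lambda>x. S x - T x)"
  using hs_on_add[OF _ hs_on_minus] by force

lemma hs_on_Pair:
  assumes "hs_on A S" "hs_on A T"
  shows "hs_on A (\<lambda>x. (S x, T x))"
proof -
  have "hs_on A (\<lambda>x. (S x, 0))" "hs_on A (\<lambda>x. (0, T x))"
    by (rule hs_on_dominated[where M = 1], rule assms, simp add: norm_prod_def)+
  from hs_on_add[OF this] show ?thesis by simp
qed

text \<open>Up to a factor, \<open>g\<close> carries Bessel families in \<open>A'\<close> to Bessel
  families in \<open>A\<close>, and homogeneity of \<open>T\<close> undoes the rescaling. As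
  \<open>g\<close> enters through finite combinations only, the lemma serves both linear maps and
  pointwise chosen preimages.\<close>

lemma hs_on_transfer:
  assumes hs: "hs_on A T" and A: "subspace A"
    and T: "\<And>r x. x \<in> A \<Longrightarrow> T (r *\<^sub>R x) = r *\<^sub>R T x"
    and g: "\<And>y. y \<in> A' \<Longrightarrow> g y \<in> A"
    and bound: "\<And>(n::nat) c y. y ` {..<n} \<subseteq> A' \<Longrightarrow>
      norm (\<Sum>i<n. c i *\<^sub>R g (y i)) \<le> M * norm (\<Sum>i<n. c i *\<^sub>R y i)"
    and S: "\<And>y. y \<in> A' \<Longrightarrow> norm (S y) \<le> norm (T (g y))"
  shows "hs_on A' S"
proof -
  obtain C where C: "\<And>n x. bessel n x \<Longrightarrow> x ` {..<n} \<subseteq> A \<Longrightarrow> (\<Sum>i<n. (norm (T (x i)))\<^sup>2) \<le> C"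
    using hs unfolding hs_on_def by blast
  define N where "N = max M 1"
  have N: "N > 0" by (simp add: N_def)
  have "(\<Sum>i<n. (norm (S (y i)))\<^sup>2) \<le> N\<^sup>2 * C" if y: "bessel n y" "y ` {..<n} \<subseteq> A'" for n y
  proof -
    define x where "x i = (1 / N) *\<^sub>R g (y i)" for i
    have le: "norm (\<Sum>i<n. c i *\<^sub>R g (y i)) \<le> N * norm (\<Sum>i<n. c i *\<^sub>R y i)" for c
      by (rule order_trans[OF bound[OF y(2)]]) (auto simp: N_def intro!: mult_right_mono)
    have "bessel n x" unfolding x_def by (rule bessel_scaled[OF y(1) N le])
    moreover have "x ` {..<n} \<subseteq> A" using y(2) g subspace_scale[OF A] by (force simp: x_def)
    ultimately have "(\<Sum>i<n. (norm (T (x i)))\<^sup>2) \<le> C" by (rule C)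
    moreover have "(norm (S (y i)))\<^sup>2 \<le> N\<^sup>2 * (norm (T (x i)))\<^sup>2" if "i < n" for i
    proof -
      have "y i \<in> A'" using y(2) that by auto
      then have "norm (S (y i)) \<le> N * norm (T (x i))"
        using S[of "y i"] N T[OF g, of "y i" "1 / N"] by (simp add: x_def)
      from power_mono[OF this norm_ge_zero, of 2] show ?thesis by (simp add: power_mult_distrib)
    qed
    then have "(\<Sum>i<n. (norm (S (y i)))\<^sup>2) \<le> (\<Sum>i<n. N\<^sup>2 * (norm (T (x i)))\<^sup>2)"
      by (intro sum_mono) auto
    moreover have "\<dots> = N\<^sup>2 * (\<Sum>i<n. (norm (T (x i)))\<^sup>2)" by (simp add: sum_distrib_left)
    ultimately show ?thesis
      by (metis (no_types, lifting) mult_left_mono order_trans zero_le_power2)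
  qed
  then show ?thesis unfolding hs_on_def by blast
qed

lemma hs_on_bounded_linear_right:
  assumes "hs_on A T" "subspace A" "linear T" and G: "bounded_linear G" and "G ` A' \<subseteq> A"
  shows "hs_on A' (\<lambda>x. T (G x))"
proof -
  obtain M where M: "\<And>x. norm (G x) \<le> norm x * M"
    using bounded_linear.bounded[OF G] by blast
  have bound: "norm (\<Sum>i<n. c i *\<^sub>R G (y i)) \<le> M * norm (\<Sum>i<n. c i *\<^sub>R y i)"
    for n and c and y :: "nat \<Rightarrow> _"
    using M[of "\<Sum>i<n. c i *\<^sub>R y i"] bounded_linear.linear[OF G]
    by (simp add: linear_sum linear_scale mult.commute)
  show ?thesis
  proof (rule hs_on_transfer[OF assms(1,2)])
    show "T (r *\<^sub>R x) = r *\<^sub>R T x" for r x by (rule linear_scale[OF assms(3)])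
    show "G y \<in> A" if "y \<in> A'" for y using that assms(5) by blast
  qed (rule bound order_refl)+
qed

text \<open>\<open>inv_into\<close> chooses lifts one point at a time. A combination of lifts stays
  in \<open>A\<close> and lies over the combination of the points, so the lower bound for
  \<open>D\<close> controls its norm.\<close>

lemma hs_on_lift:
  assumes "hs_on A T" "subspace A" "linear T" and D: "linear D"
    and bound: "\<And>x. x \<in> A \<Longrightarrow> norm x \<le> M * norm (D x)"
    and S: "\<And>x. x \<in> A \<Longrightarrow> norm (S (D x)) \<le> norm (T x)"
  shows "hs_on (D ` A) S"
proof -
  define g where "g = inv_into A D"
  have g: "g y \<in> A \<and> D (g y) = y" if "y \<in> D ` A" for y
    using that by (simp add: g_def inv_into_into f_inv_into_f)
  have lift: "norm (\<Sum>i<n. c i *\<^sub>R g (y i)) \<le> M * norm (\<Sum>i<n. c i *\<^sub>R y i)"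
    if y: "y ` {..<n} \<subseteq> D ` A" for n c y
  proof -
    have "(\<Sum>i<n. c i *\<^sub>R g (y i)) \<in> A"
      using y g by (intro subspace_sum subspace_scale assms) blast
    moreover have "D (\<Sum>i<n. c i *\<^sub>R g (y i)) = (\<Sum>i<n. c i *\<^sub>R y i)"
      unfolding linear_sum[OF D] linear_scale[OF D] using y g by (intro sum.cong) auto
    ultimately show ?thesis using bound by metis
  qed
  show ?thesis
  proof (rule hs_on_transfer[OF assms(1,2)])
    show "T (r *\<^sub>R x) = r *\<^sub>R T x" for r x by (rule linear_scale[OF assms(3)])
    show "g y \<in> A" if "y \<in> D ` A" for y using g that by blast
    show "norm (S y) \<le> norm (T (g y))" if "y \<in> D ` A" for y
      using S[of "g y"] g[OF that] by simp
  qed (rule lift)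
qed

text \<open>Expand \<open>S (y i)\<close> in an orthonormal basis \<open>G\<close> of the
  finite-dimensional span and swap the sums: \<open>inner (S (y i)) g\<close> becomes
  \<open>inner (y i) (T g)\<close>, and the dual Bessel inequality in \<open>i\<close> leaves a sum
  over \<open>G\<close> that belongs to \<open>T\<close>.\<close>

lemma hs_on_adjoint:
  assumes "hs_on UNIV T" and adj: "\<And>x y. inner (T x) y = inner x (S y)"
  shows "hs_on UNIV S"
proof -
  obtain C where C: "\<And>G. finite G \<Longrightarrow> orthonormal G \<Longrightarrow> (\<Sum>g\<in>G. (norm (T g))\<^sup>2) \<le> C"
    using hs_on_orthonormal[OF assms(1)] by auto
  have "(\<Sum>i<n. (norm (S (y i)))\<^sup>2) \<le> C" if y: "bessel n y" for n y
  proof -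
    obtain G where G: "finite G" "orthonormal G" "span G = span ((\<lambda>i. S (y i)) ` {..<n})"
      using ex_orthonormal_span[of "(\<lambda>i. S (y i)) ` {..<n}"] by blast
    have "(\<Sum>i<n. (norm (S (y i)))\<^sup>2) = (\<Sum>i<n. \<Sum>g\<in>G. (inner (S (y i)) g)\<^sup>2)"
      using G by (intro sum.cong orthonormal_norm_span) (auto intro: span_base)
    also have "\<dots> = (\<Sum>g\<in>G. \<Sum>i<n. (inner (y i) (T g))\<^sup>2)"
      by (subst sum.swap) (simp add: adj inner_commute[of _ "S _"] inner_commute[of _ "T _"])
    also have "\<dots> \<le> (\<Sum>g\<in>G. (norm (T g))\<^sup>2)" by (intro sum_mono bessel_inner_le y)
    also have "\<dots> \<le> C" using C G by blast
    finally show ?thesis .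
  qed
  then show ?thesis unfolding hs_on_def by blast
qed

text \<open>Scaled by the bound \<open>M\<close>, the values \<open>T (y i)\<close> form a Bessel
  family again, so each of the \<open>card G\<close> directions of the range contributes at most the
  square of \<open>M\<close>.\<close>

lemma hs_on_finite_rank:
  assumes T: "bounded_linear T" and A: "T ` A \<subseteq> span F" and F: "finite F"
  shows "hs_on A T"
proof -
  obtain M where M: "M > 0" "\<And>x. norm (T x) \<le> norm x * M"
    using bounded_linear.pos_bounded[OF T] by blast
  obtain G where G: "finite G" "orthonormal G" "span G = span F"
    using ex_orthonormal_span[OF F] .
  have "(\<Sum>i<n. (norm (T (y i)))\<^sup>2) \<le> card G * M\<^sup>2" if y: "bessel n y" "y ` {..<n} \<subseteq> A" for n y
  proof -
    have "norm (\<Sum>i<n. c i *\<^sub>R T (y i)) \<le> M * norm (\<Sum>i<n. c i *\<^sub>R y i)" for c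
      using M(2)[of "\<Sum>i<n. c i *\<^sub>R y i"] bounded_linear.linear[OF T]
      by (simp add: linear_sum linear_scale mult.commute)
    from bessel_scaled[OF y(1) M(1) this] have b: "bessel n (\<lambda>i. (1 / M) *\<^sub>R T (y i))" .
    have le: "(\<Sum>i<n. (inner (T (y i)) g)\<^sup>2) \<le> M\<^sup>2" if "g \<in> G" for g
      using bessel_inner_le[OF b, of g] G(2) that M(1)
      by (simp add: orthonormal_def power_divide sum_divide_distrib[symmetric] field_simps)
    have "T (y i) \<in> span G" if "i < n" for i
      using A y(2) that G(3) by blast
    then have "(\<Sum>i<n. (norm (T (y i)))\<^sup>2) = (\<Sum>i<n. \<Sum>g\<in>G. (inner (T (y i)) g)\<^sup>2)"
      using G by (intro sum.cong orthonormal_norm_span) auto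
    also have "\<dots> = (\<Sum>g\<in>G. \<Sum>i<n. (inner (T (y i)) g)\<^sup>2)" by (rule sum.swap)
    also have "\<dots> \<le> (\<Sum>g\<in>G. M\<^sup>2)" by (intro sum_mono le)
    finally show ?thesis by simp
  qed
  then show ?thesis unfolding hs_on_def by blast
qed

text \<open>One basis controls all Bessel families: after truncation to a finite part of the basis
  the double sum can be swapped as for an adjoint, and the truncations converge because
  \<open>span E\<close> is dense.\<close>

lemma hs_on_UNIV_basis:
  assumes E: "orthonormal E" "closure (span E) = UNIV" and T: "bounded_linear T"
    and C: "\<And>E0. finite E0 \<Longrightarrow> E0 \<subseteq> E \<Longrightarrow> (\<Sum>e\<in>E0. (norm (T e))\<^sup>2) \<le> C"
  shows "hs_on UNIV T"
proof -
  have lin: "linear T" by (rule bounded_linear.linear[OF T])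
  define P where "P E0 x = (\<Sum>e\<in>E0. inner x e *\<^sub>R e)" for E0 and x :: 'a
  have fin: "(\<Sum>i<n. (norm (T (P E0 (x i))))\<^sup>2) \<le> C"
    if E0: "finite E0" "E0 \<subseteq> E" and x: "bessel n x" for E0 n x
  proof -
    obtain G where G: "finite G" "orthonormal G" "span G = span (T ` E0)"
      using ex_orthonormal_span[of "T ` E0"] E0 by blast
    have oE0: "orthonormal E0" using E E0 by (auto simp: orthonormal_def intro: pairwise_subset)
    \<comment> \<open>The truncation to \<open>E0\<close> of the adjoint of \<open>T\<close> at
      \<open>g\<close>, written in coordinates.\<close>
    define w where "w g = (\<Sum>e\<in>E0. inner (T e) g *\<^sub>R e)" for g
    have TP: "T (P E0 y) = (\<Sum>e\<in>E0. inner y e *\<^sub>R T e)" for y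
      by (simp add: P_def linear_sum[OF lin] linear_scale[OF lin])
    have "(\<Sum>i<n. (norm (T (P E0 (x i))))\<^sup>2) = (\<Sum>i<n. \<Sum>g\<in>G. (inner (T (P E0 (x i))) g)\<^sup>2)"
      using G by (intro sum.cong orthonormal_norm_span refl)
        (auto simp: TP intro!: span_sum span_scale intro: span_base)
    also have "\<dots> = (\<Sum>g\<in>G. \<Sum>i<n. (inner (x i) (w g))\<^sup>2)"
      by (subst sum.swap) (simp add: TP w_def inner_sum_left inner_sum_right mult.commute)
    also have "\<dots> \<le> (\<Sum>g\<in>G. (norm (w g))\<^sup>2)" by (intro sum_mono bessel_inner_le x)
    also have "\<dots> = (\<Sum>g\<in>G. \<Sum>e\<in>E0. (inner (T e) g)\<^sup>2)"
      unfolding w_def by (simp add: orthonormal_norm_sum[OF E0(1) oE0])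
    also have "\<dots> = (\<Sum>e\<in>E0. \<Sum>g\<in>G. (inner (T e) g)\<^sup>2)" by (rule sum.swap)
    also have "\<dots> \<le> (\<Sum>e\<in>E0. (norm (T e))\<^sup>2)" by (intro sum_mono orthonormal_inner_le G)
    also have "\<dots> \<le> C" by (rule C[OF E0])
    finally show ?thesis .
  qed
  \<comment> \<open>Truncation is the best approximation from \<open>span E0\<close>. Hence an
    \<open>E0\<close> whose span contains a good approximation to each \<open>x i\<close> serves all
    of them at once.\<close>
  have best: "norm (x - P E0 x) \<le> norm (x - s)"
    if E0: "finite E0" "E0 \<subseteq> E" and s: "s \<in> span E0" for E0 x s
  proof -
    have oE0: "orthonormal E0" using E E0 by (auto simp: orthonormal_def intro: pairwise_subset)
    have "P E0 x - s \<in> span E0"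
      unfolding P_def by (intro span_diff span_sum span_scale span_base s) auto
    moreover have "orthogonal (x - P E0 x) e" if "e \<in> E0" for e
      using orthonormal_inner_sum[OF E0(1) oE0 that] by (simp add: orthogonal_def P_def inner_diff_left)
    ultimately have "orthogonal (x - P E0 x) (P E0 x - s)"
      by (meson orthogonal_to_span)
    then have "(norm (x - P E0 x + (P E0 x - s)))\<^sup>2 = (norm (x - P E0 x))\<^sup>2 + (norm (P E0 x - s))\<^sup>2"
      by (rule norm_add_Pythagorean)
    then show ?thesis by (simp add: power2_le_imp_le)
  qed
  have "(\<Sum>i<n. (norm (T (x i)))\<^sup>2) \<le> C" if x: "bessel n x" for n x
  proof -
    have "\<exists>E0. finite E0 \<and> E0 \<subseteq> E \<and> (\<forall>i<n. norm (x i - P E0 (x i)) \<le> e)" if e: "e > 0" for e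
    proof -
      have "\<exists>s\<in>span E. norm (x i - s) < e" for i
        using E(2) e closure_approachable[of "x i" "span E"]
        by (auto simp: dist_norm norm_minus_commute)
      then obtain s where s: "\<And>i. s i \<in> span E" "\<And>i. norm (x i - s i) < e" by metis
      have "\<exists>t. finite t \<and> t \<subseteq> E \<and> s i \<in> span t" for i
      proof -
        obtain t r where "finite t" "t \<subseteq> E" "s i = (\<Sum>a\<in>t. r a *\<^sub>R a)"
          using s(1)[of i] unfolding span_explicit by blast
        then show ?thesis by (metis (mono_tags, lifting) span_sum span_scale span_base)
      qed
      then obtain t where t: "\<And>i. finite (t i)" "\<And>i. t i \<subseteq> E" "\<And>i. s i \<in> span (t i)" by metis
      define E0 where "E0 = (\<Union>i<n. t i)"
      have "s i \<in> span E0" if "i < n" for i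
        using t(3)[of i] span_mono[of "t i" E0] that by (auto simp: E0_def)
      moreover have "finite E0" "E0 \<subseteq> E" using t by (auto simp: E0_def)
      ultimately show ?thesis using best s(2) by (meson order.trans less_imp_le)
    qed
    then have "\<forall>m. \<exists>E0. finite E0 \<and> E0 \<subseteq> E \<and> (\<forall>i<n. norm (x i - P E0 (x i)) \<le> inverse (real (Suc m)))"
      by simp
    then obtain F where F: "\<And>m. finite (F m)" "\<And>m. F m \<subseteq> E"
        "\<And>m i. i < n \<Longrightarrow> norm (x i - P (F m) (x i)) \<le> inverse (real (Suc m))" by metis
    have lim: "(\<lambda>m. P (F m) (x i)) \<longlonglongrightarrow> x i" if "i < n" for i
    proof (rule LIM_zero_cancel, rule Lim_null_comparison[OF _ LIMSEQ_inverse_real_of_nat])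
      show "\<forall>\<^sub>F m in sequentially. norm (P (F m) (x i) - x i) \<le> inverse (real (Suc m))"
        using F(3)[OF that] by (simp add: norm_minus_commute)
    qed
    have "(\<lambda>m. \<Sum>i<n. (norm (T (P (F m) (x i))))\<^sup>2) \<longlonglongrightarrow> (\<Sum>i<n. (norm (T (x i)))\<^sup>2)"
      by (intro tendsto_sum tendsto_power tendsto_norm bounded_linear.tendsto[OF T] lim) auto
    then show ?thesis
      by (rule LIMSEQ_le_const2) (use fin[OF F(1,2) x] in auto)
  qed
  then show ?thesis unfolding hs_on_def by blast
qed

section \<open>A semi-Fredholm criterion\<close>

text \<open>The image of \<open>S\<close> is complete, since \<open>D\<close> is bounded below
  there, and hence closed. Injectivity keeps \<open>D v\<close> outside it, at a distance
  \<open>d > 0\<close>, and this distance bounds the \<open>v\<close>-coordinate of \<open>x\<close>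
  by \<open>norm (D x) / d\<close>.\<close>

lemma bounded_below_extend:
  fixes D :: "'a::{real_inner, complete_space} \<Rightarrow> 'b::real_normed_vector"
  assumes S: "closed_sub S" and L: "subspace L" "S \<subseteq> L" and D: "bounded_linear D"
    and inj: "\<And>x. x \<in> L \<Longrightarrow> D x = 0 \<Longrightarrow> x = 0"
    and below: "\<And>x. x \<in> S \<Longrightarrow> norm x \<le> C * norm (D x)"
    and v: "v \<in> L" "\<And>x. x \<in> L \<Longrightarrow> \<exists>t. x - t *\<^sub>R v \<in> S"
  shows "\<exists>C. \<forall>x\<in>L. norm x \<le> C * norm (D x)"
proof (cases "v \<in> S")
  case True
  have "L \<subseteq> S"
    using v(2) True closed_sub.subspace[OF S]
    by (metis diff_add_cancel subsetI subspace_add subspace_scale)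
  then show ?thesis using below by blast
next
  case False
  interpret S: closed_sub S by (rule S)
  have lin: "linear D" by (rule bounded_linear.linear[OF D])
  define B where "B = max C 1"
  have B: "B > 0" by (simp add: B_def)
  have belowB: "norm x \<le> B * norm (D x)" if "x \<in> S" for x
    by (rule order_trans[OF below[OF that]]) (simp add: B_def mult_right_mono)
  then have "\<forall>x\<in>S. norm (D x) \<ge> (1 / B) * norm x"
    using B by (simp add: field_simps)
  then have "complete (D ` S)"
    using complete_isometric_image[of "1 / B" S D] B S.subspace S.closed D
    by (simp add: complete_eq_closed)
  then have cl: "closed (D ` S)" by (rule complete_imp_closed)
  have "D v \<notin> D ` S"
  proof
    assume "D v \<in> D ` S"
    then obtain s where s: "s \<in> S" "D v = D s" by blast
    then have "v - s = 0"
      using inj[of "v - s"] L v(1) by (simp add: linear_diff[OF lin] subspace_diff subsetD)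
    then show False using s False by simp
  qed
  then have d: "infdist (D v) (D ` S) > 0"
    using infdist_pos_not_in_closed[OF cl] S.subspace subspace_0 by blast
  define d where "d = infdist (D v) (D ` S)"
  have t_le: "\<bar>t\<bar> * d \<le> norm (D x)" if "x - t *\<^sub>R v \<in> S" for t x
  proof (cases "t = 0")
    case False
    \<comment> \<open>With \<open>x = s + t v\<close>, the point \<open>- s / t\<close> of
      \<open>S\<close> has its image at distance \<open>norm (D x) / \<bar>t\<bar>\<close> from
      \<open>D v\<close>.\<close>
    have "(- 1 / t) *\<^sub>R (x - t *\<^sub>R v) \<in> S" by (rule subspace_scale[OF S.subspace that])
    then have "d \<le> dist (D v) (D ((- 1 / t) *\<^sub>R (x - t *\<^sub>R v)))"
      unfolding d_def by (intro infdist_le imageI)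
    also have "\<dots> = norm ((1 / t) *\<^sub>R D x)"
      using False by (simp add: dist_norm linear_diff[OF lin] linear_scale[OF lin] algebra_simps)
    also have "\<dots> = norm (D x) / \<bar>t\<bar>" by simp
    finally show ?thesis using False by (simp add: field_simps)
  qed simp
  have "norm x \<le> (B + (B * norm (D v) + norm v) / d) * norm (D x)" if x: "x \<in> L" for x
  proof -
    obtain t where t: "x - t *\<^sub>R v \<in> S" using v(2)[OF x] by blast
    have "norm x \<le> norm (x - t *\<^sub>R v) + norm (t *\<^sub>R v)"
      using norm_triangle_sub[of x "t *\<^sub>R v"] by simp
    also have "\<dots> \<le> B * norm (D x - t *\<^sub>R D v) + \<bar>t\<bar> * norm v"
      using belowB[OF t] by (simp add: linear_diff[OF lin] linear_scale[OF lin])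
    also have "\<dots> \<le> B * (norm (D x) + \<bar>t\<bar> * norm (D v)) + \<bar>t\<bar> * norm v"
      using norm_triangle_ineq4[of "D x" "t *\<^sub>R D v"] B by (intro add_right_mono mult_left_mono) auto
    also have "\<dots> = B * norm (D x) + \<bar>t\<bar> * (B * norm (D v) + norm v)"
      by (simp add: algebra_simps)
    also have "\<dots> \<le> B * norm (D x) + norm (D x) / d * (B * norm (D v) + norm v)"
      using t_le[OF t] d B unfolding d_def[symmetric]
      by (intro add_left_mono mult_right_mono) (auto simp: field_simps)
    also have "\<dots> = (B + (B * norm (D v) + norm v) / d) * norm (D x)"
      by (simp add: algebra_simps add_divide_distrib)
    finally show ?thesis .
  qed
  then show ?thesis by blast
qed

text \<open>The vectors of \<open>F\<close> are given back one at a time by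
  \<open>bounded_below_extend\<close>. Each step worsens the constant, so the induction generalizes
  \<open>C\<close>.\<close>

lemma bounded_below_cofinite:
  fixes D :: "'a::{real_inner, complete_space} \<Rightarrow> 'b::real_normed_vector"
  assumes L: "closed_sub L" and D: "bounded_linear D"
    and inj: "\<And>x. x \<in> L \<Longrightarrow> D x = 0 \<Longrightarrow> x = 0"
    and F: "finite F" "orthonormal F" "F \<subseteq> L"
    and below: "\<And>x. x \<in> L \<inter> orthogonal_comp F \<Longrightarrow> norm x \<le> C * norm (D x)"
  shows "\<exists>C. \<forall>x\<in>L. norm x \<le> C * norm (D x)"
  using F below
proof (induction F arbitrary: C rule: finite_induct)
  case empty
  then have "\<forall>x\<in>L. norm x \<le> C * norm (D x)" by (simp add: orthogonal_comp_def)
  then show ?case by blast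
next
  case (insert v F)
  have cs: "closed_sub (L \<inter> orthogonal_comp G)" for G
    by (rule closed_sub_Int[OF L closed_sub_orthogonal_comp])
  have v: "v \<in> L" "norm v = 1" "v \<in> orthogonal_comp F"
    using insert by (auto simp: orthonormal_def orthogonal_comp_def pairwise_def)
  have "\<exists>C. \<forall>x\<in>L \<inter> orthogonal_comp F. norm x \<le> C * norm (D x)"
  proof (rule bounded_below_extend[OF cs _ _ D])
    show "subspace (L \<inter> orthogonal_comp F)" using cs closed_sub.subspace by blast
    show "L \<inter> orthogonal_comp (insert v F) \<subseteq> L \<inter> orthogonal_comp F"
      by (auto simp: orthogonal_comp_def)
    show "\<exists>t. x - t *\<^sub>R v \<in> L \<inter> orthogonal_comp (insert v F)" if x: "x \<in> L \<inter> orthogonal_comp F" for x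
    proof
      have "x - inner x v *\<^sub>R v \<in> L \<inter> orthogonal_comp F"
        using closed_sub.subspace[OF cs] x v by (intro subspace_diff subspace_scale) auto
      moreover have "inner (x - inner x v *\<^sub>R v) v = 0"
        using v(2) by (simp add: inner_diff_left norm_eq_1)
      ultimately show "x - inner x v *\<^sub>R v \<in> L \<inter> orthogonal_comp (insert v F)"
        by (simp add: orthogonal_comp_iff)
    qed
  qed (use inj v insert.prems(3) in auto)
  then show ?case
    using insert.IH insert.prems by (auto simp: orthonormal_def pairwise_insert)
qed

text \<open>Take \<open>F\<close> whose sum lies within the square of \<open>e\<close> of the
  supremum. Appending a further unit vector \<open>u\<close> orthogonal to \<open>F\<close> then
  adds less than that, so \<open>norm (K u) < e\<close>.\<close>

lemma hs_on_small:
  fixes K :: "'a::real_inner \<Rightarrow> 'b::real_inner"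
  assumes L: "subspace L" and hs: "hs_on L K" and K: "linear K" and e: "e > 0"
  shows "\<exists>F. finite F \<and> orthonormal F \<and> F \<subseteq> L \<and> (\<forall>x \<in> L \<inter> orthogonal_comp F. norm (K x) \<le> e * norm x)"
proof -
  obtain C where C: "\<And>G. finite G \<Longrightarrow> orthonormal G \<Longrightarrow> G \<subseteq> L \<Longrightarrow> (\<Sum>g\<in>G. (norm (K g))\<^sup>2) \<le> C"
    using hs_on_orthonormal[OF hs] by blast
  define S where "S = (\<lambda>G. \<Sum>g\<in>G. (norm (K g))\<^sup>2) ` {G. finite G \<and> orthonormal G \<and> G \<subseteq> L}"
  have bdd: "bdd_above S" using C by (auto simp: S_def intro!: bdd_aboveI[of _ C])
  have "{} \<in> {G. finite G \<and> orthonormal G \<and> G \<subseteq> L}" by (simp add: orthonormal_def)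
  then have "S \<noteq> {}" unfolding S_def by blast
  moreover have "Sup S - e\<^sup>2 < Sup S" using e by simp
  ultimately obtain s where "s \<in> S" "Sup S - e\<^sup>2 < s" by (meson less_cSupE)
  then obtain F where F: "finite F" "orthonormal F" "F \<subseteq> L"
      "Sup S - e\<^sup>2 < (\<Sum>g\<in>F. (norm (K g))\<^sup>2)"
    unfolding S_def by blast
  have "norm (K x) \<le> e * norm x" if x: "x \<in> L" "x \<in> orthogonal_comp F" for x
  proof (cases "x = 0")
    case True
    then show ?thesis using linear_0[OF K] by simp
  next
    case False
    define u where "u = (1 / norm x) *\<^sub>R x"
    have u: "norm u = 1" "u \<in> L" "u \<in> orthogonal_comp F"
      using False x L subspace_orthogonal_comp[of F] by (auto simp: u_def intro: subspace_scale)
    have uF: "u \<notin> F" using u by (auto simp: orthogonal_comp_def orthogonal_def norm_eq_1)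
    have "insert u F \<in> {G. finite G \<and> orthonormal G \<and> G \<subseteq> L}"
      using F u by (auto simp: orthonormal_def pairwise_insert orthogonal_comp_def orthogonal_commute)
    then have "(\<Sum>g\<in>insert u F. (norm (K g))\<^sup>2) \<in> S" unfolding S_def by blast
    then have "(\<Sum>g\<in>insert u F. (norm (K g))\<^sup>2) \<le> Sup S" by (rule cSup_upper[OF _ bdd])
    then have "(norm (K u))\<^sup>2 < e\<^sup>2" using F uF by simp
    then have "norm (K u) < e" using e power_less_imp_less_base[of "norm (K u)" 2 e] by simp
    then show ?thesis using False by (simp add: u_def linear_scale[OF K] field_simps)
  qed
  then show ?thesis using F by blast
qed

text \<open>Peetre's criterion: an a priori estimate with compact remainder gives finite-dimensional
  kernel and closed range. The remainder is taken Hilbert--Schmidt so that it also yields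
  Hilbert--Schmidt maps on the image.\<close>

locale semi_fredholm = closed_sub L
  for L :: "'a::{real_inner, complete_space} set" +
  fixes D :: "'a \<Rightarrow> 'b::{real_inner, complete_space}" and K :: "'a \<Rightarrow> 'c::real_inner" and C :: real
  assumes D: "bounded_linear D" and K: "linear K" and hs: "hs_on L K"
    and estimate: "x \<in> L \<Longrightarrow> norm x \<le> C * (norm (D x) + norm (K x))"
begin

definition "zeros = {x \<in> L. D x = 0}"

definition "coimage = L \<inter> orthogonal_comp zeros"

lemma linear_D: "linear D"
  by (rule bounded_linear.linear[OF D])

lemma restrict:
  assumes "closed_sub L'" "L' \<subseteq> L"
  shows "semi_fredholm L' D K C"
  using assms D K hs_on_subset[OF hs] estimate
  by (auto simp: semi_fredholm_def semi_fredholm_axioms_def)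

lemma below_cofinite:
  "\<exists>F B. finite F \<and> orthonormal F \<and> F \<subseteq> L \<and> (\<forall>x \<in> L \<inter> orthogonal_comp F. norm x \<le> B * norm (D x))"
proof -
  define B where "B = max C 1"
  have B: "B > 0" by (simp add: B_def)
  have estB: "norm x \<le> B * (norm (D x) + norm (K x))" if "x \<in> L" for x
    by (rule order_trans[OF estimate[OF that]]) (simp add: B_def mult_right_mono)
  \<comment> \<open>The threshold \<open>1 / (2 * B)\<close> makes the remainder at most half of
    \<open>norm x\<close>, which the left-hand side absorbs.\<close>
  obtain F where F: "finite F" "orthonormal F" "F \<subseteq> L"
      "\<And>x. x \<in> L \<inter> orthogonal_comp F \<Longrightarrow> norm (K x) \<le> 1 / (2 * B) * norm x"
    using hs_on_small[OF subspace hs K, of "1 / (2 * B)"] B by auto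
  have "norm x \<le> 2 * B * norm (D x)" if x: "x \<in> L \<inter> orthogonal_comp F" for x
  proof -
    have "norm x \<le> B * (norm (D x) + norm (K x))" using estB x by blast
    also have "\<dots> \<le> B * (norm (D x) + 1 / (2 * B) * norm x)"
      using F(4)[OF x] B by (intro mult_left_mono add_left_mono) auto
    also have "\<dots> = B * norm (D x) + norm x / 2" using B by (simp add: field_simps)
    finally show ?thesis by simp
  qed
  then show ?thesis using F by blast
qed

lemma closed_sub_zeros: "closed_sub zeros"
proof
  show "subspace zeros"
    unfolding zeros_def subspace_def using subspace
    by (auto simp: linear_0[OF linear_D] linear_add[OF linear_D] linear_scale[OF linear_D]
        subspace_0 subspace_add subspace_scale)
  have "zeros = L \<inter> {x. D x = 0}" by (auto simp: zeros_def)
  moreover have "closed {x. D x = 0}"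
    using D by (intro closed_Collect_eq linear_continuous_on continuous_on_const)
  ultimately show "closed zeros" using closed by auto
qed

text \<open>A zero of \<open>D\<close> orthogonal to \<open>F\<close> vanishes by the lower bound,
  so projecting to \<open>span F\<close> is injective on the kernel.\<close>

lemma finite_zeros: "\<exists>B. finite B \<and> span B = zeros"
proof -
  obtain F b where F: "finite F" "orthonormal F" "F \<subseteq> L"
      "\<And>x. x \<in> L \<inter> orthogonal_comp F \<Longrightarrow> norm x \<le> b * norm (D x)"
    using below_cofinite by blast
  have sub: "subspace zeros" using closed_sub_zeros closed_sub.subspace by blast
  define \<phi> where "\<phi> x = (\<Sum>f\<in>F. inner x f *\<^sub>R f)" for x
  have \<phi>: "linear \<phi>"
    by (rule linearI) (auto simp: \<phi>_def inner_add_left scaleR_add_left sum.distrib scaleR_sum_right)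
  have zero: "x = 0" if x: "x \<in> zeros" "\<phi> x = 0" for x
  proof -
    have "x \<in> orthogonal_comp F"
      using orthonormal_inner_sum[OF F(1,2), of _ "\<lambda>f. inner x f"] x(2)
      by (auto simp: orthogonal_comp_iff \<phi>_def)
    then show ?thesis using F(4)[of x] x(1) by (auto simp: zeros_def)
  qed
  then have inj: "inj_on \<phi> zeros"
    using linear_inj_on_iff_eq_0[OF \<phi> sub] by blast
  obtain B where B: "B \<subseteq> zeros" "independent B" "zeros \<subseteq> span B"
    using maximal_independent_subset[of zeros] by blast
  have sp: "span B = zeros" using B sub span_mono span_eq_iff by (metis subset_antisym)
  have "independent (\<phi> ` B)"
    using linear_independent_injective_image[OF \<phi> B(2)] inj sp by simp
  moreover have "\<phi> ` B \<subseteq> span F"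
    by (auto simp: \<phi>_def intro!: span_sum span_scale intro: span_base)
  ultimately have "finite (\<phi> ` B)" using independent_span_bound[OF F(1)] by blast
  then have "finite B" using finite_imageD inj B(1) inj_on_subset by blast
  then show ?thesis using sp by blast
qed

lemma closed_sub_coimage: "closed_sub coimage"
  unfolding coimage_def
  by (intro closed_sub_Int closed_sub_orthogonal_comp) unfold_locales

text \<open>The estimate is used afresh on \<open>coimage\<close>, so that the exceptional family
  \<open>F\<close> lies inside it. There \<open>D\<close> is injective, and
  \<open>bounded_below_cofinite\<close> removes the exceptions.\<close>

lemma coimage_below: "\<exists>B. \<forall>x\<in>coimage. norm x \<le> B * norm (D x)"
proof -
  interpret M: semi_fredholm coimage D K C
    by (rule restrict[OF closed_sub_coimage]) (simp add: coimage_def)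
  obtain F b where F: "finite F" "orthonormal F" "F \<subseteq> coimage"
      "\<And>x. x \<in> coimage \<inter> orthogonal_comp F \<Longrightarrow> norm x \<le> b * norm (D x)"
    using M.below_cofinite by blast
  have "x = 0" if x: "x \<in> coimage" "D x = 0" for x
  proof -
    have "x \<in> zeros" "x \<in> orthogonal_comp zeros" using x by (auto simp: coimage_def zeros_def)
    then have "inner x x = 0" by (auto simp: orthogonal_comp_iff)
    then show ?thesis by simp
  qed
  then show ?thesis
    using bounded_below_cofinite[OF closed_sub_coimage D _ F(1-3)] F(4) by blast
qed

lemma image_coimage: "D ` coimage = D ` L"
proof
  show "D ` L \<subseteq> D ` coimage"
  proof
    fix y assume "y \<in> D ` L"
    then obtain x where x: "x \<in> L" "y = D x" by blast
    interpret N: closed_sub zeros by (rule closed_sub_zeros)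
    have p: "proj zeros x \<in> L" "D (proj zeros x) = 0" using N.proj_in[of x] by (auto simp: zeros_def)
    have "x - proj zeros x \<in> coimage"
      using N.diff_proj_in x p subspace by (auto simp: coimage_def subspace_diff)
    moreover have "D (x - proj zeros x) = y" using p x by (simp add: linear_diff[OF linear_D])
    ultimately show "y \<in> D ` coimage" by (metis imageI)
  qed
qed (auto simp: coimage_def)

lemma closed_image: "closed_sub (D ` L)"
proof
  show "subspace (D ` L)" by (rule linear_subspace_image[OF linear_D subspace])
  obtain B where B: "\<And>x. x \<in> coimage \<Longrightarrow> norm x \<le> B * norm (D x)" using coimage_below by blast
  have "norm x \<le> max B 1 * norm (D x)" if "x \<in> coimage" for x
    by (rule order_trans[OF B[OF that]]) (simp add: mult_right_mono)
  then have "\<forall>x\<in>coimage. norm (D x) \<ge> (1 / max B 1) * norm x"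
    by (simp add: field_simps)
  then have "complete (D ` coimage)"
    using complete_isometric_image[of "1 / max B 1" coimage D] closed_sub_coimage D
    by (simp add: closed_sub_def complete_eq_closed)
  then show "closed (D ` L)" unfolding image_coimage by (rule complete_imp_closed)
qed

text \<open>Points of the image lift to \<open>coimage\<close> with controlled norm, and along the
  lift \<open>K\<close> dominates \<open>S\<close>.\<close>

lemma hs_on_image:
  assumes S: "\<And>x. x \<in> L \<Longrightarrow> norm (S (D x)) \<le> norm (K x)"
  shows "hs_on (D ` L) S"
proof -
  obtain B where B: "\<And>x. x \<in> coimage \<Longrightarrow> norm x \<le> B * norm (D x)" using coimage_below by blast
  have "hs_on (D ` coimage) S"
    using hs_on_lift[OF hs_on_subset[OF hs] _ K linear_D B, of coimage S] S
      closed_sub.subspace[OF closed_sub_coimage]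
    by (auto simp: coimage_def)
  then show ?thesis by (simp add: image_coimage)
qed

end

section \<open>Composition of Lagrangians in real Hilbert spaces\<close>

text \<open>For projections P and Q onto \<open>A\<close> and \<open>B\<close> this reads P - Q = (1
  - Q) P - Q (1 - P). The last product is the adjoint of (1 - P) Q, so two one-sided estimates
  suffice for closeness.\<close>

lemma proj_diff_eq:
  assumes "closed_sub A" "closed_sub B"
  shows "proj A x - proj B x = (proj A x - proj B (proj A x)) - proj B (x - proj A x)"
  using linear_diff[OF closed_sub.linear_proj[OF assms(2)], of x "proj A x"] by simp

lemma hs_on_diff_proj_adjoint:
  assumes A: "closed_sub A" and B: "closed_sub B" and hs: "hs_on A (\<lambda>x. x - proj B x)"
  shows "hs_on UNIV (\<lambda>x. proj A x - proj B (proj A x))"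
    and "hs_on UNIV (\<lambda>x. proj A (x - proj B x))"
proof -
  interpret A: closed_sub A by (rule A)
  interpret B: closed_sub B by (rule B)
  show *: "hs_on UNIV (\<lambda>x. proj A x - proj B (proj A x))"
    by (rule hs_on_bounded_linear_right[OF hs A.subspace _ A.bounded_linear_proj])
       (auto simp: A.proj_in intro: bounded_linear.linear B.bounded_linear_diff_proj)
  show "hs_on UNIV (\<lambda>x. proj A (x - proj B x))"
    by (rule hs_on_adjoint[OF *])
       (simp add: inner_diff_left inner_diff_right A.inner_proj B.inner_proj linear_diff[OF A.linear_proj])
qed

lemma hs_on_proj_diff:
  assumes A: "closed_sub A" and B: "closed_sub B"
    and "hs_on A (\<lambda>x. x - proj B x)" "hs_on B (\<lambda>x. x - proj A x)"
  shows "hs_on UNIV (\<lambda>x. proj A x - proj B x)"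
  unfolding proj_diff_eq[OF A B]
  by (intro hs_on_diff hs_on_diff_proj_adjoint assms)

locale reflection =
  fixes g :: "'a::real_inner \<Rightarrow> 'a"
  assumes linear: "linear g" and involution: "g (g x) = x" and selfadjoint: "inner (g x) y = inner x (g y)"
begin

lemma norm_eq: "norm (g x) = norm x"
  by (simp add: norm_eq_sqrt_inner selfadjoint involution)

lemma bounded_linear: "bounded_linear g"
  using linear norm_eq by (auto intro!: bounded_linear_intro[where K = 1] simp: linear_add linear_scale)

end

text \<open>The grading of the flipped sum is \<open>(- g0, g1)\<close>. Being Lagrangian is encoded
  as one equation, complement equals graded image, in place of isotropy together with L + \<Gamma> L
  = V; \<open>lagrangian_iff\<close> compares the two.\<close>

locale lagrangian_pair =
  G0: reflection g0 + G1: reflection g1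
  for g0 :: "'a::{real_inner, complete_space} \<Rightarrow> 'a" and g1 :: "'b::{real_inner, complete_space} \<Rightarrow> 'b" +
  fixes L :: "('a \<times> 'b) set"
  assumes closed_sub: "closed_sub L"
    and lagrangian: "orthogonal_comp L = {(- g0 a, g1 b) | a b. (a, b) \<in> L}"
begin

sublocale closed_sub L by (rule closed_sub)

lemma isotropic: "(a, b) \<in> L \<Longrightarrow> (a', b') \<in> L \<Longrightarrow> inner (g1 b) b' = inner (g0 a) a'"
proof -
  assume "(a, b) \<in> L" "(a', b') \<in> L"
  then have "(- g0 a, g1 b) \<in> orthogonal_comp L" by (auto simp: lagrangian)
  then have "inner (- g0 a, g1 b) (a', b') = 0" using \<open>(a', b') \<in> L\<close> by (auto simp: orthogonal_comp_iff)
  then show ?thesis by simp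
qed

end

text \<open>On the complement of \<open>A\<close>, which is \<open>g ` A\<close> up to finite dimension, this map has finite rank.\<close>

lemma sub_lagrangian_hs:
  fixes g :: "'a::{real_inner, complete_space} \<Rightarrow> 'a"
  assumes "reflection g" and A: "closed_sub A"
    and iso: "\<And>x y. x \<in> A \<Longrightarrow> y \<in> A \<Longrightarrow> inner (g x) y = 0"
    and F: "finite F" "\<And>x. \<exists>l\<in>A. \<exists>l'\<in>A. x - (l + g l') \<in> span F"
  shows "hs_on (orthogonal_comp A) (\<lambda>x. g x - proj A (g x))"
proof -
  interpret reflection g by fact
  interpret A: closed_sub A by (rule A)
  define T where "T x = g x - proj A (g x)" for x
  \<comment> \<open>\<open>S\<close> agrees with \<open>T\<close> on the complement of
    \<open>A\<close> and kills both \<open>A\<close> and its image under \<open>g\<close>, so only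
    the finitely many directions of \<open>F\<close> survive.\<close>
  define S where "S x = T (x - proj A x)" for x
  have bT: "bounded_linear T"
    unfolding T_def by (rule bounded_linear_compose[OF A.bounded_linear_diff_proj bounded_linear])
  have lT: "linear T" by (rule bounded_linear.linear[OF bT])
  have lS: "linear S"
    unfolding S_def using bounded_linear_compose[OF bT A.bounded_linear_diff_proj]
    by (rule bounded_linear.linear)
  have S_A: "S l = 0" if "l \<in> A" for l
    using that linear_0[OF lT] by (simp add: S_def A.proj_ident)
  have S_gA: "S (g l) = 0" if "l \<in> A" for l
  proof -
    have "g l \<in> orthogonal_comp A" using iso that by (simp add: orthogonal_comp_iff)
    then show ?thesis using that by (simp add: S_def A.proj_orthogonal T_def involution A.proj_ident)
  qed
  have "T x \<in> span (S ` F)" if x: "x \<in> orthogonal_comp A" for x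
  proof -
    obtain l l' where l: "l \<in> A" "l' \<in> A" "x - (l + g l') \<in> span F" using F(2) by blast
    have "T x = S x" using x by (simp add: S_def A.proj_orthogonal)
    also have "\<dots> = S (x - (l + g l'))"
      using S_A[OF l(1)] S_gA[OF l(2)] by (simp add: linear_diff[OF lS] linear_add[OF lS])
    also have "\<dots> \<in> span (S ` F)" using l(3) linear_span_image[OF lS, of F] by blast
    finally show ?thesis .
  qed
  then have "hs_on (orthogonal_comp A) T"
    using hs_on_finite_rank[OF bT _ finite_imageI[OF F(1)], of _ S] by blast
  then show ?thesis by (simp add: T_def[abs_def])
qed

text \<open>\<open>A1\<close> and \<open>A1'\<close> represent the same polarization: each
  Lagrangian comes with its own choice, and \<open>hs1\<close> relates them. \<open>sub0\<close> and
  \<open>iso2\<close> are what the converse estimate asks of the outer representatives.\<close>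

locale composable =
  L01: lagrangian_pair g0 g1 L01 + L12: lagrangian_pair g1 g2 L12 +
  A0: closed_sub A0 + A1: closed_sub A1 + A1': closed_sub A1' + A2: closed_sub A2
  for g0 :: "'a::{real_inner, complete_space} \<Rightarrow> 'a"
    and g1 :: "'b::{real_inner, complete_space} \<Rightarrow> 'b"
    and g2 :: "'c::{real_inner, complete_space} \<Rightarrow> 'c"
    and L01 L12 A0 A1 A1' A2 +
  assumes hs01: "hs_on UNIV (\<lambda>x. proj L01 x - proj (orthogonal_comp A0 \<times> A1) x)"
    and hs12: "hs_on UNIV (\<lambda>x. proj L12 x - proj (orthogonal_comp A1' \<times> A2) x)"
    and hs1: "hs_on UNIV (\<lambda>x. proj A1 x - proj A1' x)"
    and sub0: "hs_on (orthogonal_comp A0) (\<lambda>x. g0 x - proj A0 (g0 x))"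
    and iso2: "x \<in> A2 \<Longrightarrow> y \<in> A2 \<Longrightarrow> inner (g2 x) y = 0"
begin

definition "composite = {(a, c). \<exists>b. (a, b) \<in> L01 \<and> (b, c) \<in> L12}"

definition D :: "('a \<times> 'b) \<times> ('b \<times> 'c) \<Rightarrow> ('a \<times> 'c) \<times> 'b" where
  "D x = ((fst (fst x), snd (snd x)), snd (fst x) - fst (snd x))"

text \<open>The first four entries vanish when the two Lagrangians are the models, complement of
  \<open>A0\<close> times \<open>A1\<close> and complement of \<open>A1'\<close> times
  \<open>A2\<close>. The last entry measures the discrepancy between the two representatives in the
  middle.\<close>

definition K :: "('a \<times> 'b) \<times> ('b \<times> 'c) \<Rightarrow> ('a \<times> 'b) \<times> ('b \<times> 'c) \<times> 'b" where
  "K x = ((proj A0 (fst (fst x)), snd (fst x) - proj A1 (snd (fst x))),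
          (proj A1' (fst (snd x)), snd (snd x) - proj A2 (snd (snd x))),
          proj A1 (fst (snd x)) - proj A1' (fst (snd x)))"

section \<open>The a priori estimate for the difference map\<close>

lemma bounded_linear_D: "bounded_linear D"
  unfolding D_def[abs_def]
  by (intro bounded_linear_Pair bounded_linear_sub bounded_linear_fst_comp bounded_linear_snd_comp
      bounded_linear_ident)

lemma linear_K: "linear K"
  by (rule linearI)
     (auto simp: K_def linear_add[OF A0.linear_proj] linear_add[OF A1.linear_proj]
       linear_add[OF A1'.linear_proj] linear_add[OF A2.linear_proj]
       linear_scale[OF A0.linear_proj] linear_scale[OF A1.linear_proj]
       linear_scale[OF A1'.linear_proj] linear_scale[OF A2.linear_proj] algebra_simps)

lemma hs_K: "hs_on (L01 \<times> L12) K"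
proof -
  have l: "linear (\<lambda>x. proj L01 x - proj (orthogonal_comp A0 \<times> A1) x)"
    "linear (\<lambda>x. proj L12 x - proj (orthogonal_comp A1' \<times> A2) x)"
    "linear (\<lambda>x. proj A1 x - proj A1' x)"
    by (intro linear_compose_sub closed_sub.linear_proj closed_sub_Times closed_sub_orthogonal_comp;
        unfold_locales)+
  have "hs_on (L01 \<times> L12) (\<lambda>x. proj L01 (fst x) - proj (orthogonal_comp A0 \<times> A1) (fst x))"
    by (rule hs_on_bounded_linear_right[OF hs01 _ l(1)]) (auto intro: bounded_linear_fst)
  then have 1: "hs_on (L01 \<times> L12) (\<lambda>x. (proj A0 (fst (fst x)), snd (fst x) - proj A1 (snd (fst x))))"
    by (rule hs_on_cong)
       (auto simp: L01.proj_ident proj_Times closed_sub_orthogonal_comp A0.proj_orthogonal_comp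
         A1.closed_sub_axioms)
  have "hs_on (L01 \<times> L12) (\<lambda>x. proj L12 (snd x) - proj (orthogonal_comp A1' \<times> A2) (snd x))"
    by (rule hs_on_bounded_linear_right[OF hs12 _ l(2)]) (auto intro: bounded_linear_snd)
  then have 2: "hs_on (L01 \<times> L12) (\<lambda>x. (proj A1' (fst (snd x)), snd (snd x) - proj A2 (snd (snd x))))"
    by (rule hs_on_cong)
       (auto simp: L12.proj_ident proj_Times closed_sub_orthogonal_comp A1'.proj_orthogonal_comp
         A2.closed_sub_axioms)
  have 3: "hs_on (L01 \<times> L12) (\<lambda>x. proj A1 (fst (snd x)) - proj A1' (fst (snd x)))"
    by (rule hs_on_bounded_linear_right[OF hs1 _ l(3)])
       (auto intro: bounded_linear_fst_comp bounded_linear_snd)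
  show ?thesis unfolding K_def[abs_def] by (intro hs_on_Pair 1 2 3)
qed

text \<open>The constant: \<open>b\<close> costs one \<open>norm (D x)\<close> and three
  \<open>norm (K x)\<close>, \<open>b'\<close> one \<open>norm (D x)\<close> more, and
  \<open>a\<close> and \<open>c\<close> one each, in total 5 and 6.\<close>

lemma estimate: "norm x \<le> 6 * (norm (D x) + norm (K x))"
proof -
  obtain a b b' c where x: "x = ((a, b), (b', c))" by (metis surj_pair)
  have D: "norm a \<le> norm (D x)" "norm c \<le> norm (D x)" "norm (b - b') \<le> norm (D x)"
    using norm_fst_le[of "(a, c)" "b - b'"] norm_snd_le[of "b - b'" "(a, c)"]
      norm_fst_le[of a c] norm_snd_le[of c a] by (simp_all add: D_def x)
  have K: "norm (b - proj A1 b) \<le> norm (K x)" "norm (proj A1' b') \<le> norm (K x)"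
      "norm (proj A1 b' - proj A1' b') \<le> norm (K x)"
    unfolding K_def x fst_conv snd_conv by (meson norm_fst_le norm_snd_le order_trans)+
  \<comment> \<open>Only the second summand involves \<open>b - b'\<close>. The others are entries
    of \<open>K x\<close>; the third pays for replacing \<open>A1\<close> by
    \<open>A1'\<close>.\<close>
  have "b = (b - proj A1 b) + proj A1 (b - b') + (proj A1 b' - proj A1' b') + proj A1' b'"
    by (simp add: linear_diff[OF A1.linear_proj])
  then have "norm b \<le> norm (b - proj A1 b) + norm (proj A1 (b - b')) + norm (proj A1 b' - proj A1' b') + norm (proj A1' b')"
    by (metis (no_types, lifting) norm_triangle_le norm_triangle_ineq add_right_mono)
  then have b: "norm b \<le> norm (D x) + 3 * norm (K x)"
    using D K A1.norm_proj_le[of "b - b'"] by linarith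
  have "norm b' \<le> norm b + norm (b - b')" by (metis norm_minus_commute norm_triangle_sub)
  moreover have "norm x \<le> (norm a + norm b) + (norm b' + norm c)"
    unfolding x using norm_Pair_le[of "(a, b)" "(b', c)"] norm_Pair_le[of a b] norm_Pair_le[of b' c]
    by linarith
  ultimately have "norm x \<le> 6 * norm (D x) + 6 * norm (K x)"
    using D b norm_ge_zero[of "D x"] by linarith
  then show ?thesis by simp
qed

sublocale SF: semi_fredholm "L01 \<times> L12" D K 6
  by (intro semi_fredholm.intro semi_fredholm_axioms.intro closed_sub_Times L01.closed_sub
      L12.closed_sub bounded_linear_D linear_K hs_K estimate)

section \<open>The fiber, its kernel and the composite relation\<close>

definition "fiber = (L01 \<times> L12) \<inter> {x. snd (fst x) = fst (snd x)}"

definition outer :: "('a \<times> 'b) \<times> ('b \<times> 'c) \<Rightarrow> 'a \<times> 'c" where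
  "outer x = (fst (fst x), snd (snd x))"

lemma bounded_linear_outer: "bounded_linear outer"
  unfolding outer_def[abs_def]
  by (intro bounded_linear_Pair bounded_linear_fst_comp bounded_linear_snd_comp bounded_linear_ident)

lemma closed_sub_fiber: "closed_sub fiber"
proof -
  have "closed {x :: ('a \<times> 'b) \<times> ('b \<times> 'c). snd (fst x) = fst (snd x)}"
    by (intro closed_Collect_eq continuous_intros)
  then have "closed_sub {x :: ('a \<times> 'b) \<times> ('b \<times> 'c). snd (fst x) = fst (snd x)}"
    by (simp add: closed_sub_def subspace_def)
  then show ?thesis unfolding fiber_def
    by (intro closed_sub_Int closed_sub_Times L01.closed_sub L12.closed_sub)
qed

text \<open>On the fiber the difference entry of \<open>D\<close> is zero, so \<open>outer\<close>
  inherits the estimate with the same constant and remainder.\<close>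

sublocale SFF: semi_fredholm fiber outer K 6
proof (intro semi_fredholm.intro semi_fredholm_axioms.intro closed_sub_fiber bounded_linear_outer linear_K)
  show "hs_on fiber K" using hs_on_subset[OF hs_K] by (simp add: fiber_def)
  show "norm x \<le> 6 * (norm (outer x) + norm (K x))" if "x \<in> fiber" for x
  proof -
    have "D x = (outer x, 0)" using that by (auto simp: D_def outer_def fiber_def)
    then have "norm (D x) = norm (outer x)" by (simp add: norm_prod_def)
    then show ?thesis using estimate[of x] by simp
  qed
qed

lemma outer_fiber: "outer ` fiber = composite"
  by (force simp: outer_def fiber_def composite_def image_iff)

sublocale C: closed_sub composite
  using SFF.closed_image by (simp add: outer_fiber)

text \<open>The zeros of \<open>outer\<close> on the fiber are the points
  \<open>((0, b), (b, 0))\<close>, so the middle coordinate identifies them with the set in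
  question.\<close>

lemma finite_fiber: "\<exists>B. finite B \<and> span B = {b. (0, b) \<in> L01 \<and> (b, 0) \<in> L12}"
proof -
  obtain B where B: "finite B" "span B = SFF.zeros" using SFF.finite_zeros by blast
  have lin: "linear (\<lambda>x :: ('a \<times> 'b) \<times> ('b \<times> 'c). snd (fst x))" by (rule linearI) auto
  have "{b. (0, b) \<in> L01 \<and> (b, 0) \<in> L12} = (\<lambda>x. snd (fst x)) ` SFF.zeros"
  proof (intro set_eqI iffI)
    fix b assume "b \<in> {b. (0, b) \<in> L01 \<and> (b, 0) \<in> L12}"
    then have "((0, b), (b, 0)) \<in> SFF.zeros"
      unfolding SFF.zeros_def by (simp add: fiber_def outer_def zero_prod_def)
    then show "b \<in> (\<lambda>x. snd (fst x)) ` SFF.zeros" by force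
  next
    fix b assume "b \<in> (\<lambda>x. snd (fst x)) ` SFF.zeros"
    then show "b \<in> {b. (0, b) \<in> L01 \<and> (b, 0) \<in> L12}"
      unfolding SFF.zeros_def by (auto simp: fiber_def outer_def zero_prod_def)
  qed
  also have "\<dots> = span ((\<lambda>x. snd (fst x)) ` B)"
    using linear_span_image[OF lin, of B] B by simp
  finally show ?thesis using B(1) by blast
qed

section \<open>Maximality of the composite relation\<close>

definition G :: "'a \<times> 'c \<Rightarrow> 'a \<times> 'c" where "G x = (- g0 (fst x), g2 (snd x))"

sublocale G: reflection G
  by unfold_locales
     (auto intro!: linearI simp: G_def linear_add[OF L01.G0.linear] linear_scale[OF L01.G0.linear]
       linear_add[OF L12.G1.linear] linear_scale[OF L12.G1.linear] linear_neg[OF L01.G0.linear]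
       L01.G0.involution L12.G1.involution L01.G0.selfadjoint L12.G1.selfadjoint inner_prod_def)

text \<open>Isotropy: the middle terms cancel, as the middle space occurs once flipped and once
  unflipped. Maximality: a vector orthogonal to the composite, padded by zeros in the middle, is
  orthogonal to the fiber and hence lies in \<open>M\<close>; unfolding membership in
  \<open>M\<close> produces the missing middle point.\<close>

lemma orthogonal_comp_composite: "orthogonal_comp composite = G ` composite"
proof
  show "G ` composite \<subseteq> orthogonal_comp composite"
    using L01.isotropic L12.isotropic by (fastforce simp: orthogonal_comp_iff composite_def G_def)
next
  define \<Gamma> :: "('a \<times> 'b) \<times> ('b \<times> 'c) \<Rightarrow> ('a \<times> 'b) \<times> ('b \<times> 'c)" where
    "\<Gamma> x = ((- g0 (fst (fst x)), g1 (snd (fst x))), (- g1 (fst (snd x)), g2 (snd (snd x))))" for x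
  \<comment> \<open>\<open>M\<close> is the sum of the orthogonal complements of \<open>L01 \<times> L12\<close> and of \<open>{b = b'}\<close>, written as
    a preimage so that it is visibly closed.\<close>
  define M where "M = {x. D (\<Gamma> x) \<in> D ` (L01 \<times> L12)}"
  have b\<Gamma>: "bounded_linear \<Gamma>"
    unfolding \<Gamma>_def[abs_def]
    by (intro bounded_linear_Pair bounded_linear_minus bounded_linear_fst_comp bounded_linear_snd_comp
        bounded_linear_compose[OF L01.G0.bounded_linear] bounded_linear_compose[OF L01.G1.bounded_linear]
        bounded_linear_compose[OF L12.G1.bounded_linear] bounded_linear_ident)
  have bD\<Gamma>: "bounded_linear (\<lambda>x. D (\<Gamma> x))" by (rule bounded_linear_compose[OF bounded_linear_D b\<Gamma>])
  have "closed ((\<lambda>x. D (\<Gamma> x)) -` (D ` (L01 \<times> L12)))"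
    using SF.closed_image linear_continuous_on[OF bD\<Gamma>, of UNIV]
    by (intro continuous_closed_vimage) (auto simp: closed_sub_def continuous_on_eq_continuous_at)
  moreover have "subspace ((\<lambda>x. D (\<Gamma> x)) -` (D ` (L01 \<times> L12)))"
    using SF.closed_image bounded_linear.linear[OF bD\<Gamma>]
    by (intro linear_subspace_vimage) (auto simp: closed_sub_def)
  ultimately have M: "closed_sub M" by (simp add: M_def closed_sub_def vimage_def)
  \<comment> \<open>The wanted inclusion is \<open>fM\<close>; as \<open>M\<close> is closed, it
    follows from this one by taking complements.\<close>
  have "orthogonal_comp M \<subseteq> fiber"
  proof
    fix x assume x: "x \<in> orthogonal_comp M"
    obtain a b b' c where x': "x = ((a, b), (b', c))" by (metis surj_pair)
    have "orthogonal_comp (L01 \<times> L12) \<subseteq> M"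
    proof
      fix y assume y: "y \<in> orthogonal_comp (L01 \<times> L12)"
      have "fst y \<in> orthogonal_comp L01"
        using y subspace_0[OF L12.subspace] by (fastforce simp: orthogonal_comp_iff inner_prod_def)
      moreover have "snd y \<in> orthogonal_comp L12"
        using y subspace_0[OF L01.subspace] by (fastforce simp: orthogonal_comp_iff inner_prod_def)
      ultimately have "\<Gamma> y \<in> L01 \<times> L12"
        by (auto simp: L01.lagrangian L12.lagrangian \<Gamma>_def L01.G0.involution L01.G1.involution
            L12.G1.involution linear_neg[OF L01.G0.linear] linear_neg[OF L01.G1.linear] mem_Times_iff)
      then show "y \<in> M" by (simp add: M_def)
    qed
    then have "x \<in> orthogonal_comp (orthogonal_comp (L01 \<times> L12))"
      using x orthogonal_comp_anti_mono by blast
    then have "x \<in> L01 \<times> L12" by (simp add: SF.orthogonal_comp_twice)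
    moreover have "b = b'"
    proof -
      \<comment> \<open>\<open>\<Gamma>\<close> turns the middle entries into equal ones, so
        \<open>D\<close> then gives 0. Pairing with \<open>x\<close> gives the squared norm of
        \<open>b - b'\<close>.\<close>
      have "((0, b - b'), (b' - b, 0)) \<in> M"
        using subspace_0[OF SF.closed_image[THEN closed_sub.subspace]]
        by (simp add: M_def \<Gamma>_def D_def linear_0[OF L01.G0.linear] linear_0[OF L12.G1.linear]
            linear_diff[OF L01.G1.linear] zero_prod_def)
      then have "inner x ((0, b - b'), (b' - b, 0)) = 0"
        using x by (simp add: orthogonal_comp_iff)
      then have "inner (b - b') (b - b') = 0"
        by (simp add: x' inner_diff_left inner_diff_right)
      then show ?thesis by simp
    qed
    ultimately show "x \<in> fiber" by (simp add: fiber_def x')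
  qed
  then have fM: "orthogonal_comp fiber \<subseteq> M"
    using orthogonal_comp_anti_mono closed_sub.orthogonal_comp_twice[OF M] by blast
  show "orthogonal_comp composite \<subseteq> G ` composite"
  proof
    fix z assume z: "z \<in> orthogonal_comp composite"
    have "((fst z, 0), (0, snd z)) \<in> orthogonal_comp fiber"
      using z unfolding outer_fiber[symmetric] by (auto simp: orthogonal_comp_iff outer_def inner_prod_def)
    then have "D (\<Gamma> ((fst z, 0), (0, snd z))) \<in> D ` (L01 \<times> L12)" using fM by (auto simp: M_def)
    then obtain a b b' c where "(a, b) \<in> L01" "(b', c) \<in> L12"
        "D (\<Gamma> ((fst z, 0), (0, snd z))) = D ((a, b), (b', c))"
      by auto
    \<comment> \<open>The difference entry of the equation says \<open>b = b'\<close>; the outer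
      entry identifies \<open>a\<close> and \<open>c\<close>.\<close>
    then have "(- g0 (fst z), g2 (snd z)) \<in> composite"
      by (auto simp: D_def \<Gamma>_def composite_def linear_0[OF L01.G1.linear])
    moreover have "z = G (- g0 (fst z), g2 (snd z))"
      by (simp add: G_def L01.G0.involution L12.G1.involution linear_neg[OF L01.G0.linear])
    ultimately show "z \<in> G ` composite" by blast
  qed
qed

text \<open>\<open>G\<close> is orthogonal and exchanges the composite with its complement, so it
  conjugates the two projections into each other.\<close>

lemma diff_proj_composite: "x - proj composite x = G (proj composite (G x))"
  unfolding C.proj_orthogonal_comp[symmetric]
proof (rule closed_sub.proj_eq[OF closed_sub_orthogonal_comp])
  show "G (proj composite (G x)) \<in> orthogonal_comp composite"
    by (simp add: orthogonal_comp_composite C.proj_in)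
  show "inner (x - G (proj composite (G x))) y = 0" if "y \<in> orthogonal_comp composite" for y
  proof -
    have "y \<in> G ` composite" using that by (simp add: orthogonal_comp_composite)
    then obtain w where w: "w \<in> composite" "y = G w" by blast
    have "inner (x - G (proj composite (G x))) y = inner (G x - proj composite (G x)) w"
      by (simp add: w inner_diff_left G.selfadjoint G.involution)
    then show ?thesis using C.inner_diff_proj[OF w(1)] by simp
  qed
qed

lemma hs_composite: "hs_on UNIV (\<lambda>x. proj composite x - proj (orthogonal_comp A0 \<times> A2) x)"
proof -
  define Y where "Y = orthogonal_comp A0 \<times> A2"
  interpret Y: closed_sub Y
    unfolding Y_def by (intro closed_sub_Times closed_sub_orthogonal_comp) unfold_locales
  have pY: "proj Y y = (fst y - proj A0 (fst y), proj A2 (snd y))" for y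
    unfolding Y_def by (simp add: proj_Times closed_sub_orthogonal_comp A2.closed_sub_axioms A0.proj_orthogonal_comp)
  \<comment> \<open>The deviation of \<open>outer x\<close> from \<open>Y\<close> consists of two
    entries of \<open>K x\<close>.\<close>
  have "hs_on (outer ` fiber) (\<lambda>y. y - proj Y y)"
  proof (rule SFF.hs_on_image)
    fix x :: "('a \<times> 'b) \<times> ('b \<times> 'c)"
    obtain a b b' c where x: "x = ((a, b), (b', c))" by (metis surj_pair)
    have "norm (outer x - proj Y (outer x)) = norm (proj A0 a, c - proj A2 c)"
      by (simp add: x outer_def pY)
    also have "\<dots> \<le> norm (K x)"
      by (simp add: x K_def norm_prod_def)
    finally show "norm (outer x - proj Y (outer x)) \<le> norm (K x)" .
  qed
  then have 1: "hs_on composite (\<lambda>y. y - proj Y y)" by (simp add: outer_fiber)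
  have "hs_on UNIV (\<lambda>x. proj composite (x - proj Y x))"
    by (rule hs_on_diff_proj_adjoint(2)[OF C.closed_sub_axioms Y.closed_sub_axioms 1])
  \<comment> \<open>The part of \<open>G y\<close> off \<open>Y\<close>, by the adjoint of the first
    estimate.\<close>
  then have 2: "hs_on Y (\<lambda>y. proj composite (G y - proj Y (G y)))"
    by (rule hs_on_bounded_linear_right[OF _ subspace_UNIV _ G.bounded_linear])
       (auto intro!: bounded_linear.linear bounded_linear_compose[OF C.bounded_linear_proj]
         Y.bounded_linear_diff_proj)
  have lin: "linear (\<lambda>x. g0 x - proj A0 (g0 x))"
    using bounded_linear_compose[OF A0.bounded_linear_diff_proj L01.G0.bounded_linear]
    by (rule bounded_linear.linear)
  have "hs_on Y (\<lambda>y. - (g0 (fst y) - proj A0 (g0 (fst y))))"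
    by (intro hs_on_minus hs_on_bounded_linear_right[OF sub0 subspace_orthogonal_comp lin bounded_linear_fst])
       (auto simp: Y_def)
  moreover have "hs_on Y (\<lambda>y. 0 :: 'c)"
    by (rule hs_on_finite_rank[where F = "{}"]) auto
  ultimately have "hs_on Y (\<lambda>y. (- (g0 (fst y) - proj A0 (g0 (fst y))), 0 :: 'c))"
    by (rule hs_on_Pair)
  \<comment> \<open>The part of \<open>G y\<close> inside \<open>Y\<close>: up to a Hilbert--Schmidt
    error \<open>g0\<close> maps the complement of \<open>A0\<close> into \<open>A0\<close>, and
    isotropy of \<open>A2\<close> kills the second coordinate.\<close>
  then have "hs_on Y (\<lambda>y. proj Y (G y))"
  proof (rule hs_on_cong)
    fix y assume "y \<in> Y"
    then have "g2 (snd y) \<in> orthogonal_comp A2"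
      using iso2 by (auto simp: Y_def orthogonal_comp_iff)
    then show "proj Y (G y) = (- (g0 (fst y) - proj A0 (g0 (fst y))), 0 :: 'c)"
      by (simp add: pY G_def A2.proj_orthogonal linear_neg[OF A0.linear_proj])
  qed
  then have "hs_on Y (\<lambda>y. proj composite (proj Y (G y)))"
    by (rule hs_on_bounded_linear_left[OF _ C.bounded_linear_proj])
  from hs_on_add[OF 2 this] have "hs_on Y (\<lambda>y. proj composite (G y))"
    by (simp add: linear_diff[OF C.linear_proj])
  then have "hs_on Y (\<lambda>y. y - proj composite y)"
    unfolding diff_proj_composite by (rule hs_on_bounded_linear_left[OF _ G.bounded_linear])
  with 1 show ?thesis
    using hs_on_proj_diff[OF C.closed_sub_axioms Y.closed_sub_axioms] by (simp add: Y_def)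
qed

end

section \<open>The scalar field\<close>

lemma conjg_0 [simp]: "conjg (0::'k::real_or_complex) = 0"
  using conjg_add[of "0::'k" 0] by simp

lemma conjg_minus [simp]: "conjg (- x) = - conjg (x::'k::real_or_complex)"
  using conjg_add[of x "- x"] by (simp add: eq_neg_iff_add_eq_0 add.commute)

lemma mult_conjg': "x * conjg x = of_real ((norm (x::'k::real_or_complex))\<^sup>2)"
  by (simp add: mult_conjg scaleR_conv_of_real)

lemma conjg_of_real [simp]: "conjg (of_real a) = (of_real a :: 'k::real_or_complex)"
  using mult_conjg'[of "of_real a :: 'k"]
  by (cases "a = 0") (auto simp: power2_eq_square)

lemma conjg_1 [simp]: "conjg (1::'k::real_or_complex) = 1"
  using conjg_of_real[of 1] by simp

text \<open>Twice the real part is recovered from norms by expanding the squared norm of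
  \<open>c + 1\<close>.\<close>

lemma ex_Re:
  fixes c :: "'k::real_or_complex"
  shows "\<exists>r. c + conjg c = of_real (2 * r)"
proof
  have "(c + 1) * conjg (c + 1) = c * conjg c + c + conjg c + 1"
    by (simp add: conjg_add algebra_simps)
  then show "c + conjg c = of_real (2 * (((norm (c + 1))\<^sup>2 - (norm c)\<^sup>2 - 1) / 2))"
    by (simp add: mult_conjg')
qed

text \<open>Each scalar is a real number plus some \<open>u\<close> with
  \<open>conjg u = - u\<close>. For such \<open>u\<close> the square of \<open>u\<close> is minus
  its squared norm, which is also the square of \<open>norm u\<close> times \<open>i\<close>;
  factoring the difference of squares leaves \<open>u\<close> equal to plus or minus
  \<open>norm u\<close> times \<open>i\<close>. The value \<open>i = 0\<close> covers the real
  field.\<close>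

lemma ex_imaginary_unit:
  "\<exists>i::'k::real_or_complex. (\<forall>c. \<exists>a b. c = of_real a + of_real b * i) \<and>
     (i = 0 \<or> norm i = 1 \<and> conjg i = - i)"
proof -
  have dec: "\<exists>r w. c = of_real r + w \<and> conjg w = - w" for c :: 'k
  proof -
    obtain r where r: "c + conjg c = of_real (2 * r)" using ex_Re by blast
    have "conjg (c - of_real r) = conjg c - of_real r"
      using conjg_add[of c "- of_real r"] by simp
    also have "\<dots> = - (c - of_real r)" using r by (simp add: algebra_simps eq_diff_eq)
    finally show ?thesis by (metis add.commute diff_add_cancel)
  qed
  show ?thesis
  proof (cases "\<exists>w::'k. w \<noteq> 0 \<and> conjg w = - w")
    case False
    then have "\<exists>a. c = of_real a" for c :: 'k using dec[of c] by (metis add_0_right)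
    then have "\<exists>a b. c = of_real a + of_real b * 0" for c :: 'k by simp
    then show ?thesis by blast
  next
    case True
    then obtain w :: 'k where w: "w \<noteq> 0" "conjg w = - w" by blast
    define i where "i = of_real (1 / norm w) * w"
    have ci: "conjg i = - i" unfolding i_def conjg_mult conjg_of_real w by simp
    have ni: "norm i = 1" using w by (simp add: i_def norm_divide)
    have i2: "i * i = - 1" using mult_conjg'[of i] ci ni by (simp add: minus_equation_iff)
    have "\<exists>b. u = of_real b * i" if u: "conjg u = - u" for u
    proof -
      have "u * u = - of_real ((norm u)\<^sup>2)"
        using mult_conjg'[of u] u by (metis mult_minus_right minus_minus)
      moreover have "(u - of_real (norm u) * i) * (u + of_real (norm u) * i)
          = u * u - of_real ((norm u)\<^sup>2) * (i * i)"
        by (simp add: algebra_simps power2_eq_square)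
      ultimately have "(u - of_real (norm u) * i) * (u + of_real (norm u) * i) = 0"
        using i2 by simp
      then have "u = of_real (norm u) * i \<or> u = of_real (- norm u) * i"
        by (auto simp: eq_neg_iff_add_eq_0)
      then show ?thesis by blast
    qed
    then have "\<exists>a b. c = of_real a + of_real b * i" for c using dec[of c] by blast
    then show ?thesis using ci ni by blast
  qed
qed

section \<open>Hilbert spaces over the scalar field\<close>

locale hilb =
  fixes V :: "('k::real_or_complex, 'v::{real_inner, complete_space}) cl_hilbert"
  assumes hilbert: "hilbert_space V"
begin

sublocale vs: vector_space "scl V"
  using hilbert unfolding hilbert_space_def by blast

lemma scl_of_real: "scl V (of_real a) x = a *\<^sub>R x"
  using hilbert unfolding hilbert_space_def by blast

lemma ip_add_left: "ip V (x + y) z = ip V x z + ip V y z"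
  using hilbert unfolding hilbert_space_def by blast

lemma ip_scl_left: "ip V (scl V c x) y = c * ip V x y"
  using hilbert unfolding hilbert_space_def by blast

lemma ip_sym: "conjg (ip V x y) = ip V y x"
  using hilbert unfolding hilbert_space_def by metis

lemma ip_self: "ip V x x = of_real ((norm x)\<^sup>2)"
  using hilbert unfolding hilbert_space_def by blast

lemma ip_add_right: "ip V x (y + z) = ip V x y + ip V x z"
  by (metis ip_sym ip_add_left conjg_add)

lemma ip_scl_right: "ip V x (scl V c y) = conjg c * ip V x y"
  by (metis ip_sym ip_scl_left conjg_mult)

lemma ip_minus_left: "ip V (- x) y = - ip V x y"
  using ip_scl_left[of "of_real (- 1)" x y] scl_of_real[of "- 1" x] by simp

text \<open>Both products are recovered from the same norm by polarization;
  \<open>c + conjg c\<close> stands for twice the real part.\<close>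

lemma ip_inner: "ip V x y + conjg (ip V x y) = of_real (2 * inner x y)"
proof -
  have "of_real ((norm (x + y))\<^sup>2) = ip V (x + y) (x + y)" by (rule ip_self[symmetric])
  also have "\<dots> = ip V x x + ip V y y + (ip V x y + ip V y x)"
    by (simp add: ip_add_left ip_add_right)
  also have "\<dots> = of_real ((norm x)\<^sup>2 + (norm y)\<^sup>2) + (ip V x y + conjg (ip V x y))"
    by (simp add: ip_self ip_sym)
  finally have "ip V x y + conjg (ip V x y)
      = of_real ((norm (x + y))\<^sup>2 - ((norm x)\<^sup>2 + (norm y)\<^sup>2))"
    by (simp only: of_real_diff) (simp add: algebra_simps)
  then show ?thesis by (simp add: dot_norm)
qed

lemma inner_eq_0: "ip V x y = 0 \<Longrightarrow> inner x y = 0"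
  using ip_inner[of x y] by simp

lemma norm_scl: "norm (scl V c x) = norm c * norm x"
proof -
  have "of_real ((norm (scl V c x))\<^sup>2) = ip V (scl V c x) (scl V c x)" by (rule ip_self[symmetric])
  also have "\<dots> = (c * conjg c) * ip V x x" by (simp add: ip_scl_left ip_scl_right)
  also have "\<dots> = of_real ((norm c * norm x)\<^sup>2)"
    by (simp only: mult_conjg' ip_self of_real_mult[symmetric] power_mult_distrib)
  finally have "(norm (scl V c x))\<^sup>2 = (norm c * norm x)\<^sup>2" by (simp only: of_real_eq_iff)
  then show ?thesis by (simp add: power2_eq_iff_nonneg)
qed

lemma subspace_real: "vs.subspace S \<Longrightarrow> subspace S"
  unfolding vs.subspace_def subspace_def by (metis scl_of_real)

lemma closed_sub: "closed_subspace V S \<Longrightarrow> closed_sub S"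
  by (simp add: closed_subspace_def closed_sub_def subspace_real)

text \<open>A subspace over the scalars also contains the multiple of \<open>y\<close> by
  \<open>c = ip V x y\<close>. Pairing \<open>x\<close> with it gives the squared norm of
  \<open>c\<close>, a real number, so a vanishing real inner product forces
  \<open>c = 0\<close>.\<close>

lemma ortho_compl: "vs.subspace S \<Longrightarrow> ortho_compl V S = orthogonal_comp S"
proof (intro set_eqI iffI)
  fix x assume S: "vs.subspace S" and x: "x \<in> orthogonal_comp S"
  have "ip V x y = 0" if y: "y \<in> S" for y
  proof -
    define c where "c = ip V x y"
    have "ip V x (scl V c y) = c * conjg c" by (simp add: ip_scl_right c_def)
    then have "ip V x (scl V c y) = of_real ((norm c)\<^sup>2)" by (simp only: mult_conjg')
    moreover have "inner x (scl V c y) = 0"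
      using x vs.subspace_scale[OF S y] by (simp add: orthogonal_comp_iff)
    ultimately have "of_real ((norm c)\<^sup>2 + (norm c)\<^sup>2) = (of_real 0 :: 'k)"
      using ip_inner[of x "scl V c y"] by (simp only: conjg_of_real of_real_add mult_zero_right)
    then show ?thesis unfolding of_real_eq_iff by (simp add: c_def)
  qed
  then show "x \<in> ortho_compl V S" by (simp add: ortho_compl_def)
qed (auto simp: ortho_compl_def orthogonal_comp_iff inner_eq_0)

lemma subspace_ortho_compl: "vs.subspace (ortho_compl V S)"
  unfolding vs.subspace_def ortho_compl_def
  using ip_add_left ip_scl_left ip_minus_left[of 0] ip_scl_left[of 0 0] by auto

lemma ortho_proj: "vs.subspace S \<Longrightarrow> ortho_proj V S = proj S"
  by (simp add: fun_eq_iff ortho_proj_def proj_def ortho_compl)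

lemma linear_proj:
  assumes "closed_subspace V S"
  shows "Vector_Spaces.linear (scl V) (scl V) (proj S)"
proof -
  have S: "vs.subspace S" using assms by (simp add: closed_subspace_def)
  interpret S: closed_sub S by (rule closed_sub[OF assms])
  have "proj S (scl V c x) = scl V c (proj S x)" for c x
  proof (rule proj_eqI[OF S.subspace])
    show "scl V c (proj S x) \<in> S" by (rule vs.subspace_scale[OF S S.proj_in])
    have "scl V c (x - proj S x) \<in> ortho_compl V S"
      using vs.subspace_scale[OF subspace_ortho_compl] S.diff_proj_in ortho_compl[OF S] by blast
    then show "scl V c x - scl V c (proj S x) \<in> orthogonal_comp S"
      by (simp add: ortho_compl[OF S] vs.scale_right_diff_distrib)
  qed
  then show ?thesis
    by (simp add: Vector_Spaces.linear_iff vs.vector_space_axioms linear_add[OF S.linear_proj])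
qed

text \<open>\<open>unit_im\<close> is \<open>0\<close> over the real numbers.\<close>

definition unit_im :: 'k where
  "unit_im = (SOME i. (\<forall>c. \<exists>a b. c = of_real a + of_real b * i) \<and> (i = 0 \<or> norm i = 1 \<and> conjg i = - i))"

lemma unit_im: "\<exists>a b. c = of_real a + of_real b * unit_im"
    "unit_im = 0 \<or> norm unit_im = 1 \<and> conjg unit_im = - unit_im"
  using someI_ex[OF ex_imaginary_unit[where 'k = 'k]] unfolding unit_im_def[symmetric] by blast+

lemma span_subset: "vs.span S \<subseteq> span (S \<union> scl V unit_im ` S)"
proof
  fix x assume "x \<in> vs.span S"
  then show "x \<in> span (S \<union> scl V unit_im ` S)"
  proof (induction rule: vs.span_induct_alt)
    case base
    then show ?case by (rule span_zero)
  next
    case (step c x y)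
    obtain a b where c: "c = of_real a + of_real b * unit_im" using unit_im by blast
    have "scl V c x = a *\<^sub>R x + b *\<^sub>R scl V unit_im x"
      by (simp add: c vs.scale_left_distrib scl_of_real flip: vs.scale_scale)
    also have "\<dots> \<in> span (S \<union> scl V unit_im ` S)"
      using step(1) by (intro span_add span_scale span_base) auto
    finally show ?case using step(2) span_add by blast
  qed
qed

lemma finite_codim_real:
  assumes "vs.subspace U" "finite F" "vs.span (U \<union> F) = UNIV"
  shows "\<exists>u\<in>U. x - u \<in> span (F \<union> scl V unit_im ` F)"
proof -
  obtain u s where "u \<in> U" "s \<in> vs.span F" "x = u + s"
    using assms vs.span_Un[of U F] vs.span_eq_iff[of U] by blast
  then show ?thesis using span_subset[of F] by (intro bexI[of _ u]) auto
qed

lemma finite_dim_real: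
  assumes "vs.subspace U" "span F = U"
  shows "vs.span F = U"
proof
  show "vs.span F \<subseteq> U" using assms span_superset by (intro vs.span_minimal) auto
  show "U \<subseteq> vs.span F"
    unfolding assms(2)[symmetric] by (intro span_minimal vs.span_superset subspace_real vs.subspace_span)
qed

text \<open>Over the complex numbers the basis and its multiples by \<open>unit_im\<close> form a
  real basis. Over the real numbers those multiples are all 0 and are removed.\<close>

lemma real_orthonormal_basis:
  assumes E: "orthonormal_basis V E"
  defines "E' \<equiv> E \<union> scl V unit_im ` E - {0}"
  shows "orthonormal E'" "closure (span E') = UNIV"
proof -
  have ipE: "ip V x y = (if x = y then 1 else 0)" if "x \<in> E" "y \<in> E" for x y
    using E that by (simp add: orthonormal_basis_def)
  have nE: "norm x = 1" if "x \<in> E" for x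
  proof -
    have "of_real ((norm x)\<^sup>2) = (of_real 1 :: 'k)" using ip_self[of x] ipE[OF that that] by simp
    then have "(norm x)\<^sup>2 = 1" by (simp only: of_real_eq_iff)
    then show ?thesis using norm_ge_zero[of x] by (auto simp: power2_eq_1_iff)
  qed
  have "norm x = 1" if "x \<in> E'" for x
    using that nE unit_im(2) by (auto simp: E'_def norm_scl)
  moreover have "inner x y = 0" if "x \<in> E'" "y \<in> E'" "x \<noteq> y" for x y
  proof -
    have 1: "inner u v = 0" if "u \<in> E" "v \<in> E" "u \<noteq> v" for u v
      using ipE that by (simp add: inner_eq_0)
    have 2: "inner (scl V unit_im u) (scl V unit_im v) = 0" if "u \<in> E" "v \<in> E" "u \<noteq> v" for u v
      using ipE that by (simp add: inner_eq_0 ip_scl_left ip_scl_right)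
    \<comment> \<open>This includes \<open>u = v\<close>: there the scalar product is
      \<open>- unit_im\<close>, which cancels against its conjugate.\<close>
    have 3: "inner u (scl V unit_im v) = 0" if "u \<in> E" "v \<in> E" for u v
    proof -
      have "ip V u (scl V unit_im v) + conjg (ip V u (scl V unit_im v)) = 0"
        using ipE[OF that] unit_im(2) by (auto simp: ip_scl_right)
      then show ?thesis using ip_inner[of u "scl V unit_im v"] by simp
    qed
    show ?thesis
      using that 1 2 3 unfolding E'_def by (auto simp: inner_commute)
  qed
  ultimately show "orthonormal E'"
    by (auto simp: orthonormal_def pairwise_def orthogonal_def)
  have "vs.span E \<subseteq> span (E \<union> scl V unit_im ` E)" by (rule span_subset)
  also have "\<dots> = span E'" by (simp add: E'_def)
  finally have "closure (vs.span E) \<subseteq> closure (span E')" by (rule closure_mono)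
  then show "closure (span E') = UNIV" using E by (auto simp: orthonormal_basis_def)
qed

section \<open>Comparison with the basis definition of Hilbert--Schmidt maps\<close>

lemma hilbert_schmidt_hs_on:
  assumes "hilbert_schmidt V T"
  shows "hs_on UNIV T"
proof -
  obtain E where E: "orthonormal_basis V E" "(\<lambda>e. (norm (T e))\<^sup>2) summable_on E"
    and T: "bounded_linear T" "\<And>c x. T (scl V c x) = scl V c (T x)"
    using assms by (auto simp: hilbert_schmidt_def Vector_Spaces.linear_iff)
  define S where "S = infsum (\<lambda>e. (norm (T e))\<^sup>2) E"
  have S: "(\<Sum>e\<in>A. (norm (T e))\<^sup>2) \<le> S" if "finite A" "A \<subseteq> E" for A
    unfolding S_def by (rule finite_sum_le_infsum[OF E(2) that]) simp
  \<comment> \<open>Passing to the real basis at most doubles the sum: \<open>T\<close> commutes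
    with \<open>unit_im\<close>, whose norm is at most 1.\<close>
  show ?thesis
  proof (rule hs_on_UNIV_basis[OF real_orthonormal_basis[OF E(1)] T(1), where C = "S + S"])
    fix A assume A: "finite A" "A \<subseteq> E \<union> scl V unit_im ` E - {0}"
    then have "A - E \<subseteq> scl V unit_im ` E" by blast
    then obtain B where B: "B \<subseteq> E" "finite B" "A - E = scl V unit_im ` B"
      using finite_subset_image[of "A - E" "scl V unit_im" E] A(1) by auto
    have "(\<Sum>e\<in>A - E. (norm (T e))\<^sup>2) \<le> (\<Sum>e\<in>B. (norm (T (scl V unit_im e)))\<^sup>2)"
      using sum_image_le[OF B(2), of "\<lambda>e. (norm (T e))\<^sup>2" "scl V unit_im"] by (simp add: B(3) o_def)
    also have "\<dots> \<le> (\<Sum>e\<in>B. (norm (T e))\<^sup>2)"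
      using unit_im(2) by (intro sum_mono) (auto simp: T(2) norm_scl)
    also have "\<dots> \<le> S" by (rule S[OF B(2,1)])
    finally have "(\<Sum>e\<in>A - E. (norm (T e))\<^sup>2) \<le> S" .
    moreover have "(\<Sum>e\<in>A \<inter> E. (norm (T e))\<^sup>2) \<le> S" using A by (intro S) auto
    moreover have "(\<Sum>e\<in>A. (norm (T e))\<^sup>2) = (\<Sum>e\<in>A \<inter> E. (norm (T e))\<^sup>2) + (\<Sum>e\<in>A - E. (norm (T e))\<^sup>2)"
      using A(1) by (rule sum.Int_Diff)
    ultimately show "(\<Sum>e\<in>A. (norm (T e))\<^sup>2) \<le> S + S" by linarith
  qed
qed

text \<open>The definition asks for an orthonormal basis to exist, so one is supplied as
  \<open>E\<close>; it is part of the associated real basis and hence orthonormal in the real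
  sense.\<close>

lemma hs_on_hilbert_schmidt:
  assumes hs: "hs_on UNIV T" and T: "Vector_Spaces.linear (scl V) (scl V) T" "bounded_linear T"
    and E: "orthonormal_basis V E"
  shows "hilbert_schmidt V T"
proof -
  obtain C where C: "\<And>G. finite G \<Longrightarrow> orthonormal G \<Longrightarrow> (\<Sum>g\<in>G. (norm (T g))\<^sup>2) \<le> C"
    using hs_on_orthonormal[OF hs] by auto
  have "0 \<notin> E" using E ip_scl_left[of 0 0 0] by (auto simp: orthonormal_basis_def)
  then have "orthonormal G" if "G \<subseteq> E" for G
    using real_orthonormal_basis(1)[OF E] that unfolding orthonormal_def
    by (auto intro: pairwise_subset)
  then have "bdd_above (sum (\<lambda>e. (norm (T e))\<^sup>2) ` {F. F \<subseteq> E \<and> finite F})"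
    using C by (auto intro!: bdd_aboveI[of _ C])
  then have "(\<lambda>e. (norm (T e))\<^sup>2) summable_on E"
    by (intro nonneg_bdd_above_summable_on) auto
  then show ?thesis using T E by (auto simp: hilbert_schmidt_def)
qed

lemma close_hs_on:
  assumes "close V A B"
  shows "hs_on UNIV (\<lambda>x. proj A x - proj B x)"
proof -
  have "ortho_proj V A = proj A" "ortho_proj V B = proj B"
    using assms by (auto simp: close_def closed_subspace_def ortho_proj)
  then show ?thesis using assms hilbert_schmidt_hs_on by (simp add: close_def)
qed

lemma hs_on_close:
  assumes A: "closed_subspace V A" and B: "closed_subspace V B"
    and hs: "hs_on UNIV (\<lambda>x. proj A x - proj B x)" and E: "orthonormal_basis V E"
  shows "close V A B"
proof -
  have "Vector_Spaces.linear (scl V) (scl V) (\<lambda>x. proj A x - proj B x)"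
    using linear_proj[OF A] linear_proj[OF B]
    by (simp add: Vector_Spaces.linear_iff vs.scale_right_diff_distrib)
  moreover have "bounded_linear (\<lambda>x. proj A x - proj B x)"
    by (intro bounded_linear_sub closed_sub.bounded_linear_proj closed_sub A B)
  moreover have "ortho_proj V A = proj A" "ortho_proj V B = proj B"
    using A B by (auto simp: closed_subspace_def ortho_proj)
  ultimately show ?thesis
    using A B hs_on_hilbert_schmidt[OF hs _ _ E] by (simp add: close_def)
qed

lemma close_ex_orthonormal_basis: "close V A B \<Longrightarrow> \<exists>E. orthonormal_basis V E"
  by (auto simp: close_def hilbert_schmidt_def)

text \<open>If \<open>z\<close> is orthogonal to \<open>L\<close> and z = x + \<Gamma> y with
  \<open>x\<close> and \<open>y\<close> in \<open>L\<close>, then x = z - \<Gamma> y is in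
  \<open>L\<close> and orthogonal to it, so it is 0. Conversely, the orthogonal decomposition along
  \<open>L\<close> has the form x + \<Gamma> y.\<close>

lemma lagrangian_iff:
  assumes "reflection (grading V)"
  shows "lagrangian d V L \<longleftrightarrow> closed_subspace V L \<and> clifford_submodule d V L \<and>
    orthogonal_comp L = grading V ` L"
proof -
  interpret g: reflection "grading V" by fact
  have "isotropic V L \<and> plus_grading V L = UNIV \<longleftrightarrow> orthogonal_comp L = grading V ` L"
    if cs: "closed_subspace V L"
  proof -
    interpret L: closed_sub L by (rule closed_sub[OF cs])
    have oc: "ortho_compl V L = orthogonal_comp L"
      using cs ortho_compl by (simp add: closed_subspace_def)
    have iso: "isotropic V L \<longleftrightarrow> grading V ` L \<subseteq> orthogonal_comp L"
      unfolding oc[symmetric] by (auto simp: isotropic_def bform_def ortho_compl_def)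
    have "orthogonal_comp L \<subseteq> grading V ` L"
      if i: "isotropic V L" and p: "plus_grading V L = UNIV"
    proof
      fix z assume z: "z \<in> orthogonal_comp L"
      obtain x y where xy: "z = x + grading V y" "x \<in> L" "y \<in> L"
        using p unfolding plus_grading_def by blast
      have "grading V y \<in> orthogonal_comp L" using i iso xy by blast
      then have "z - grading V y \<in> orthogonal_comp L"
        using z subspace_orthogonal_comp by (rule_tac subspace_diff)
      then have "inner x x = 0" using xy by (auto simp: orthogonal_comp_iff)
      then show "z \<in> grading V ` L" using xy by simp
    qed
    moreover have "plus_grading V L = UNIV" if "orthogonal_comp L = grading V ` L"
    proof -
      have "z \<in> plus_grading V L" for z
      proof -
        have "z - proj L z \<in> grading V ` L" using L.diff_proj_in that by blast
        then obtain y where "y \<in> L" "z - proj L z = grading V y" by blast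
        then have "z = proj L z + grading V y" "y \<in> L" by (auto simp: algebra_simps)
        then show ?thesis using L.proj_in unfolding plus_grading_def by blast
      qed
      then show ?thesis by blast
    qed
    ultimately show ?thesis using iso by blast
  qed
  moreover have "finite_codimensional V UNIV"
    using vs.span_UNIV unfolding finite_codimensional_def by (intro exI[of _ "{}"]) auto
  ultimately show ?thesis by (auto simp: lagrangian_def sub_lagrangian_def)
qed

end

locale super_hilb = hilb +
  assumes super: "super_hilbert_space V"
begin

lemma grading_scl: "grading V (scl V c x) = scl V c (grading V x)"
  and reflection_grading: "reflection (grading V)"
proof -
  obtain Vp Vm where sub: "vs.subspace Vp" "vs.subspace Vm"
    and orth: "\<And>u v. u \<in> Vp \<Longrightarrow> v \<in> Vm \<Longrightarrow> ip V u v = 0"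
    and dec: "\<And>x. \<exists>u\<in>Vp. \<exists>v\<in>Vm. x = u + v"
    and g: "\<And>u v. u \<in> Vp \<Longrightarrow> v \<in> Vm \<Longrightarrow> grading V (u + v) = u - v"
    using super unfolding super_hilbert_space_def by blast
  have scl: "grading V (scl V c x) = scl V c (grading V x)" for c x
  proof -
    obtain u v where "u \<in> Vp" "v \<in> Vm" "x = u + v" using dec by blast
    then show ?thesis
      using g[of "scl V c u" "scl V c v"] g[of u v] sub
      by (simp add: vs.subspace_scale vs.scale_right_distrib vs.scale_right_diff_distrib)
  qed
  then show "grading V (scl V c x) = scl V c (grading V x)" .
  show "reflection (grading V)"
  proof (rule reflection.intro)
    show "linear (grading V)"
    proof (rule linearI)
      fix x y
      obtain u v u' v' where uv: "u \<in> Vp" "v \<in> Vm" "x = u + v" "u' \<in> Vp" "v' \<in> Vm" "y = u' + v'"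
        using dec by meson
      have "grading V (x + y) = grading V ((u + u') + (v + v'))" using uv by (simp add: ac_simps)
      also have "\<dots> = (u + u') - (v + v')" using uv sub by (intro g vs.subspace_add)
      also have "\<dots> = grading V x + grading V y" using uv g by simp
      finally show "grading V (x + y) = grading V x + grading V y" .
      show "grading V (r *\<^sub>R x) = r *\<^sub>R grading V x" for r
        using scl[of "of_real r" x] by (simp add: scl_of_real)
    qed
    show "grading V (grading V x) = x" for x
    proof -
      obtain u v where "u \<in> Vp" "v \<in> Vm" "x = u + v" using dec by blast
      then show ?thesis
        using g[of u "- v"] g[of u v] sub by (simp add: vs.subspace_neg)
    qed
    show "inner (grading V x) y = inner x (grading V y)" for x y
    proof -
      obtain u v u' v' where uv: "u \<in> Vp" "v \<in> Vm" "x = u + v" "u' \<in> Vp" "v' \<in> Vm" "y = u' + v'"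
        using dec by meson
      then have "inner u v' = 0" "inner u' v = 0" using orth inner_eq_0 by blast+
      then show ?thesis
        using uv g[of u v] g[of u' v'] by (simp add: inner_add_left inner_add_right
            inner_diff_left inner_diff_right inner_commute)
    qed
  qed
qed

sublocale g: reflection "grading V"
  by (rule reflection_grading)

lemma sub_lagrangian_isotropic:
  "sub_lagrangian d V L \<Longrightarrow> x \<in> L \<Longrightarrow> y \<in> L \<Longrightarrow> inner (grading V x) y = 0"
  by (auto simp: sub_lagrangian_def isotropic_def bform_def intro: inner_eq_0)

lemma sub_lagrangian_hs_on:
  assumes L: "sub_lagrangian d V L"
  shows "hs_on (orthogonal_comp L) (\<lambda>x. grading V x - proj L (grading V x))"
proof -
  have cs: "closed_subspace V L" using L by (simp add: sub_lagrangian_def)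
  then have sub: "vs.subspace L" by (simp add: closed_subspace_def)
  have "vs.subspace (plus_grading V L)"
  proof (rule vs.subspaceI)
    show "0 \<in> plus_grading V L"
      using vs.subspace_0[OF sub] linear_0[OF g.linear] by (force simp: plus_grading_def)
    show "scl V c x \<in> plus_grading V L" if x: "x \<in> plus_grading V L" for c x
    proof -
      obtain a b where "a \<in> L" "b \<in> L" "x = a + grading V b" using x by (auto simp: plus_grading_def)
      then have "scl V c x = scl V c a + grading V (scl V c b)" "scl V c a \<in> L" "scl V c b \<in> L"
        using vs.subspace_scale[OF sub] by (simp_all add: vs.scale_right_distrib grading_scl)
      then show ?thesis unfolding plus_grading_def by blast
    qed
    show "x + y \<in> plus_grading V L" if xy: "x \<in> plus_grading V L" "y \<in> plus_grading V L" for x y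
    proof -
      obtain a b a' b' where "a \<in> L" "b \<in> L" "x = a + grading V b" "a' \<in> L" "b' \<in> L" "y = a' + grading V b'"
        using xy by (auto simp: plus_grading_def)
      then have "x + y = (a + a') + grading V (b + b')" "a + a' \<in> L" "b + b' \<in> L"
        using vs.subspace_add[OF sub] by (simp_all add: linear_add[OF g.linear] algebra_simps)
      then show ?thesis unfolding plus_grading_def by blast
    qed
  qed
  moreover obtain F where F: "finite F" "vs.span (plus_grading V L \<union> F) = UNIV"
    using L by (auto simp: sub_lagrangian_def finite_codimensional_def)
  ultimately have "\<exists>u\<in>plus_grading V L. x - u \<in> span (F \<union> scl V unit_im ` F)" for x
    by (rule finite_codim_real)
  then have "\<exists>l\<in>L. \<exists>l'\<in>L. x - (l + grading V l') \<in> span (F \<union> scl V unit_im ` F)" for x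
    unfolding plus_grading_def by blast
  then show ?thesis
    using F(1) by (intro sub_lagrangian_hs[OF reflection_grading closed_sub[OF cs]
          sub_lagrangian_isotropic[OF L], where F = "F \<union> scl V unit_im ` F"]) auto
qed

text \<open>Members are compared through the base point of the class. Closeness to the base point is
  also what provides an orthonormal basis.\<close>

lemma polarization:
  assumes P: "polarization d V P" and L: "L \<in> P"
  shows "sub_lagrangian d V L" and "\<exists>E. orthonormal_basis V E"
    and "L' \<in> P \<Longrightarrow> hs_on UNIV (\<lambda>x. proj L x - proj L' x)"
proof -
  obtain B where B: "P = {L. sub_lagrangian d V L \<and> close V B L}"
    using P by (auto simp: polarization_def)
  then show "sub_lagrangian d V L" "\<exists>E. orthonormal_basis V E"
    using L close_ex_orthonormal_basis by auto
  assume "L' \<in> P"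
  then have "hs_on UNIV (\<lambda>x. proj B x - proj L x)" "hs_on UNIV (\<lambda>x. proj B x - proj L' x)"
    using B L close_hs_on by auto
  from hs_on_diff[OF this(2,1)] show "hs_on UNIV (\<lambda>x. proj L x - proj L' x)" by simp
qed

end

lemma super_hilb: "polarized_hilbert_space d V P \<Longrightarrow> super_hilb V"
  by (simp add: polarized_hilbert_space_def degree_hilbert_space_def super_hilbert_space_def
      super_hilb_def super_hilb_axioms_def hilb_def)

section \<open>Sums of Hilbert spaces and of modules\<close>

lemma span_map_prod:
  fixes s :: "'k::field \<Rightarrow> 'v::ab_group_add \<Rightarrow> 'v" and t :: "'k \<Rightarrow> 'w::ab_group_add \<Rightarrow> 'w"
  assumes "vector_space s" "vector_space t"
  shows vector_space_map_prod: "vector_space (\<lambda>c. map_prod (s c) (t c))"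
    and "module.span s A \<times> module.span t B
      \<subseteq> module.span (\<lambda>c. map_prod (s c) (t c)) (A \<times> {0} \<union> {0} \<times> B)"
proof -
  interpret p: vector_space_prod s t
    by (intro vector_space_prod.intro vector_space_pair.intro assms)
  have eq: "p.scale = (\<lambda>c. map_prod (s c) (t c))"
    by (auto simp: fun_eq_iff p.scale_def)
  show "vector_space (\<lambda>c. map_prod (s c) (t c))"
    using p.p.vector_space_axioms by (simp add: eq)
  have "(a, b) \<in> p.p.span (A \<times> {0} \<union> {0} \<times> B)" if "a \<in> p.vs1.span A" "b \<in> p.vs2.span B" for a b
  proof -
    have "(a, 0) \<in> p.p.span (A \<times> {0})" "(0, b) \<in> p.p.span ({0} \<times> B)"
      using that by (simp_all add: p.span_Times_sing1 p.span_Times_sing2)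
    then have "(a, 0) + (0, b) \<in> p.p.span (A \<times> {0} \<union> {0} \<times> B)"
      unfolding p.p.span_Un by blast
    then show ?thesis by simp
  qed
  then show "module.span s A \<times> module.span t B
      \<subseteq> module.span (\<lambda>c. map_prod (s c) (t c)) (A \<times> {0} \<union> {0} \<times> B)"
    by (auto simp: eq)
qed

text \<open>Rank and nullity for a map that is linear on \<open>S\<close> only: preimages of
  generators of the image, together with \<open>F\<close>, span \<open>S\<close>.\<close>

lemma finite_span_extension:
  fixes s :: "'k::field \<Rightarrow> 'v::ab_group_add \<Rightarrow> 'v" and t :: "'k \<Rightarrow> 'w::ab_group_add \<Rightarrow> 'w"
  assumes "vector_space s" "vector_space t" and S: "module.subspace s S"
    and add: "\<And>x y. x \<in> S \<Longrightarrow> y \<in> S \<Longrightarrow> T (x + y) = T x + T y"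
    and scale: "\<And>c x. x \<in> S \<Longrightarrow> T (s c x) = t c (T x)"
    and B: "finite B" "module.span t B = T ` S"
    and F: "finite F" "F \<subseteq> S" "{x \<in> S. T x = 0} \<subseteq> module.span s F"
  shows "\<exists>F. finite F \<and> module.span s F = S"
proof -
  interpret s: vector_space s by fact
  interpret t: vector_space t by fact
  have "B \<subseteq> T ` S" using B(2) t.span_superset by blast
  from finite_subset_image[OF B(1) this]
  obtain B' where B': "B' \<subseteq> S" "finite B'" "B = T ` B'" by blast
  define F' where "F' = F \<union> B'"
  have F': "s.span F' \<subseteq> S" using F B' S by (intro s.span_minimal) (auto simp: F'_def)
  have "t.subspace (T ` s.span F')"
  proof (rule t.subspaceI)
    have "T 0 = 0" using scale[OF s.subspace_0[OF S], of 0] by simp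
    then show "0 \<in> T ` s.span F'" using s.span_zero by (metis imageI)
    fix x y c assume "x \<in> T ` s.span F'"
    then obtain u where u: "u \<in> s.span F'" "x = T u" by blast
    then have "t c x = T (s c u)" "s c u \<in> s.span F'" using scale F' s.span_scale by auto
    then show "t c x \<in> T ` s.span F'" by blast
    assume "y \<in> T ` s.span F'"
    then obtain v where v: "v \<in> s.span F'" "y = T v" by blast
    have "x + y = T (u + v)" using u v add[of u v] F' by (simp add: subset_iff)
    moreover have "u + v \<in> s.span F'" using u(1) v(1) by (rule s.span_add)
    ultimately show "x + y \<in> T ` s.span F'" by blast
  qed
  moreover have "B \<subseteq> T ` s.span F'" using B'(3) s.span_base by (auto simp: F'_def)
  ultimately have TS: "T ` S \<subseteq> T ` s.span F'" unfolding B(2)[symmetric] by (rule t.span_minimal[rotated])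
  have "x \<in> s.span F'" if x: "x \<in> S" for x
  proof -
    obtain y where y: "y \<in> s.span F'" "T x = T y" using TS x by blast
    have d: "x - y \<in> S" using x y F' s.subspace_diff[OF S] by blast
    have "T ((x - y) + y) = T (x - y) + T y" using d y F' by (intro add) auto
    then have "T (x - y) = 0" using y by simp
    then have "x - y \<in> s.span F'" using d F(3) s.span_mono[of F F'] by (auto simp: F'_def)
    then have "(x - y) + y \<in> s.span F'" using y(1) by (rule s.span_add)
    then show ?thesis by simp
  qed
  then have "s.span F' = S" using F' by blast
  then show ?thesis using F(1) B'(2) by (auto simp: F'_def)
qed

lemma hilb_parity_flip: "hilb V \<Longrightarrow> hilb (parity_flip V)"
proof -
  have "scl (parity_flip V) = scl V" "ip (parity_flip V) = ip V"
    by (simp_all add: parity_flip_def)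
  then have "hilbert_space (parity_flip V) = hilbert_space V" by (simp only: hilbert_space_def)
  then show "hilb V \<Longrightarrow> hilb (parity_flip V)" by (simp add: hilb_def)
qed

lemma hilb_hilbert_sum:
  assumes "hilb V" "hilb W"
  shows "hilb (hilbert_sum V W)"
proof -
  interpret V: hilb V by fact
  interpret W: hilb W by fact
  have "vector_space (\<lambda>c. map_prod (scl V c) (scl W c))"
    by (rule vector_space_map_prod[OF V.vs.vector_space_axioms W.vs.vector_space_axioms])
  moreover have "ip V a a + ip W b b = of_real ((norm (a, b))\<^sup>2)" for a b
    by (simp only: norm_prod_def fst_conv snd_conv V.ip_self W.ip_self)
       (simp flip: of_real_power)
  ultimately show ?thesis
    by (auto simp: hilb_def hilbert_space_def hilbert_sum_def V.scl_of_real W.scl_of_real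
        V.ip_add_left W.ip_add_left V.ip_scl_left W.ip_scl_left V.ip_sym W.ip_sym conjg_add algebra_simps)
qed

lemma orthonormal_basis_sum:
  assumes "hilb V" "hilb W" and E: "orthonormal_basis V E" and F: "orthonormal_basis W F"
  shows "orthonormal_basis (hilbert_sum (parity_flip V) W) (E \<times> {0} \<union> {0} \<times> F)"
proof -
  interpret V: hilb V by fact
  interpret W: hilb W by fact
  have ip0: "ip V 0 x = 0" "ip V x 0 = 0" "ip W 0 y = 0" "ip W y 0 = 0" for x y
    using V.ip_scl_left[of 0 0 x] V.ip_scl_right[of x 0 0] W.ip_scl_left[of 0 0 y] W.ip_scl_right[of y 0 0]
    by simp_all
  have "ip V 0 0 \<noteq> 1" "ip W 0 0 \<noteq> 1" by (simp_all add: ip0)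
  then have n0: "0 \<notin> E" "0 \<notin> F" using E F by (auto simp: orthonormal_basis_def)
  have "UNIV = closure (V.vs.span E \<times> W.vs.span F)"
    using E F by (simp add: closure_Times orthonormal_basis_def)
  also have "\<dots> \<subseteq> closure (module.span (\<lambda>c. map_prod (scl V c) (scl W c)) (E \<times> {0} \<union> {0} \<times> F))"
    by (intro closure_mono span_map_prod(2) V.vs.vector_space_axioms W.vs.vector_space_axioms)
  finally have dense: "closure (module.span (\<lambda>c. map_prod (scl V c) (scl W c)) (E \<times> {0} \<union> {0} \<times> F)) = UNIV"
    by blast
  have ipE: "ip V x y = (if x = y then 1 else 0)" if "x \<in> E" "y \<in> E" for x y
    using E that by (simp add: orthonormal_basis_def)
  have ipF: "ip W x y = (if x = y then 1 else 0)" if "x \<in> F" "y \<in> F" for x y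
    using F that by (simp add: orthonormal_basis_def)
  have "ip V (fst x) (fst y) + ip W (snd x) (snd y) = (if x = y then 1 else 0)"
    if "x \<in> E \<times> {0} \<union> {0} \<times> F" "y \<in> E \<times> {0} \<union> {0} \<times> F" for x y
    using that n0 by (cases "x = y") (auto simp: ipE ipF ip0 split: if_splits)
  then show ?thesis
    unfolding orthonormal_basis_def hilbert_sum_def parity_flip_def using dense by simp
qed

lemma hilbert_sum_simps [simp]:
  "scl (hilbert_sum (parity_flip V) W) c (a, b) = (scl V c a, scl W c b)"
  "cl (hilbert_sum (parity_flip V) W) j (a, b) = (cl V j a, cl W j b)"
  "grading (hilbert_sum (parity_flip V) W) = (\<lambda>x. (- grading V (fst x), grading W (snd x)))"
  by (auto simp: hilbert_sum_def parity_flip_def)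

lemma reflection_sum:
  assumes "reflection g" "reflection h"
  shows "reflection (\<lambda>x. (- g (fst x), h (snd x)))"
proof -
  interpret g: reflection g by fact
  interpret h: reflection h by fact
  show ?thesis
    by unfold_locales
       (auto intro!: linearI simp: linear_add[OF g.linear] linear_scale[OF g.linear]
         linear_add[OF h.linear] linear_scale[OF h.linear] linear_neg[OF g.linear]
         g.involution h.involution g.selfadjoint h.selfadjoint inner_prod_def)
qed

text \<open>Separates the conditions that involve the scalars and the Clifford action from the real
  condition under which relations are composed.\<close>

lemma lagrangian_sum_iff:
  assumes "super_hilb V" "super_hilb W"
  shows "lagrangian d (hilbert_sum (parity_flip V) W) L \<longleftrightarrow>
    closed_subspace (hilbert_sum (parity_flip V) W) L \<and>
    clifford_submodule d (hilbert_sum (parity_flip V) W) L \<and>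
    lagrangian_pair (grading V) (grading W) L"
proof -
  interpret V: super_hilb V by fact
  interpret W: super_hilb W by fact
  interpret X: hilb "hilbert_sum (parity_flip V) W"
    by (intro hilb_hilbert_sum hilb_parity_flip V.hilb_axioms W.hilb_axioms)
  have "(\<lambda>x. (- grading V (fst x), grading W (snd x))) ` L = {(- grading V a, grading W b) | a b. (a, b) \<in> L}"
    by force
  then show ?thesis
    using X.lagrangian_iff[unfolded hilbert_sum_simps, OF reflection_sum[OF V.reflection_grading W.reflection_grading]]
      X.closed_sub V.reflection_grading W.reflection_grading
    by (auto simp: lagrangian_pair_def lagrangian_pair_axioms_def)
qed

lemma close_sum_hs_on:
  assumes "hilb V" "hilb W" "close (hilbert_sum (parity_flip V) W) L (ortho_compl V A \<times> B)"
    and "closed_subspace V A"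
  shows "hs_on UNIV (\<lambda>x. proj L x - proj (orthogonal_comp A \<times> B) x)"
proof -
  interpret X: hilb "hilbert_sum (parity_flip V) W"
    by (intro hilb_hilbert_sum hilb_parity_flip assms)
  have "ortho_compl V A = orthogonal_comp A"
    using hilb.ortho_compl[OF assms(1)] assms(4) by (simp add: closed_subspace_def)
  then show ?thesis using X.close_hs_on[OF assms(3)] by simp
qed

section \<open>Composition of generalized Lagrangians\<close>

lemma clifford_module_sum:
  assumes "clifford_module d M" "clifford_module d N"
  shows "clifford_module d (clifford_module_sum M N)"
proof -
  have vs: "vector_space (scl M)" "vector_space (scl N)"
    and lin: "\<And>j. j \<in> {1..d} \<Longrightarrow> Vector_Spaces.linear (scl M) (scl M) (cl M j)"
      "\<And>j. j \<in> {1..d} \<Longrightarrow> Vector_Spaces.linear (scl N) (scl N) (cl N j)"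
    and sq: "\<And>j x. j \<in> {1..d} \<Longrightarrow> cl M j (cl M j x) = - x"
      "\<And>j x. j \<in> {1..d} \<Longrightarrow> cl N j (cl N j x) = - x"
    and anti: "\<And>i j x. i \<in> {1..d} \<Longrightarrow> j \<in> {1..d} \<Longrightarrow> i \<noteq> j \<Longrightarrow> cl M i (cl M j x) = - cl M j (cl M i x)"
      "\<And>i j x. i \<in> {1..d} \<Longrightarrow> j \<in> {1..d} \<Longrightarrow> i \<noteq> j \<Longrightarrow> cl N i (cl N j x) = - cl N j (cl N i x)"
    using assms unfolding clifford_module_def by blast+
  have vsp: "vector_space (scl (clifford_module_sum M N))"
    using vector_space_map_prod[OF vs] by (simp add: clifford_module_sum_def)
  have "Vector_Spaces.linear (scl (clifford_module_sum M N)) (scl (clifford_module_sum M N))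
      (cl (clifford_module_sum M N) j)" if "j \<in> {1..d}" for j
    using lin[OF that] vsp by (simp add: Vector_Spaces.linear_iff clifford_module_sum_def)
  moreover have "cl (clifford_module_sum M N) j (cl (clifford_module_sum M N) j x) = - x"
    if "j \<in> {1..d}" for j x
    by (cases x) (simp add: clifford_module_sum_def sq[OF that])
  moreover have "cl (clifford_module_sum M N) i (cl (clifford_module_sum M N) j x)
      = - cl (clifford_module_sum M N) j (cl (clifford_module_sum M N) i x)"
    if "i \<in> {1..d}" "j \<in> {1..d}" "i \<noteq> j" for i j x
    using anti(1)[OF that, of "fst x"] anti(2)[OF that, of "snd x"]
    by (cases x) (simp add: clifford_module_sum_def)
  ultimately show ?thesis unfolding clifford_module_def using vsp by blast
qed

lemma clifford_submoduleI:
  assumes "vector_space (scl M)" "0 \<in> S" "\<And>x y. x \<in> S \<Longrightarrow> y \<in> S \<Longrightarrow> x + y \<in> S"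
    "\<And>c x. x \<in> S \<Longrightarrow> scl M c x \<in> S" "\<And>j x. j \<in> {1..d} \<Longrightarrow> x \<in> S \<Longrightarrow> cl M j x \<in> S"
  shows "clifford_submodule d M S"
proof -
  interpret vector_space "scl M" by fact
  show ?thesis using assms by (auto simp: clifford_submodule_def subspace_def)
qed

lemma clifford_submoduleD:
  assumes "vector_space (scl M)" "clifford_submodule d M S"
  shows "0 \<in> S" "x \<in> S \<Longrightarrow> y \<in> S \<Longrightarrow> x + y \<in> S" "x \<in> S \<Longrightarrow> scl M c x \<in> S"
    "j \<in> {1..d} \<Longrightarrow> x \<in> S \<Longrightarrow> cl M j x \<in> S"
proof -
  interpret vector_space "scl M" by fact
  show "0 \<in> S" "x \<in> S \<Longrightarrow> y \<in> S \<Longrightarrow> x + y \<in> S" "x \<in> S \<Longrightarrow> scl M c x \<in> S"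
    "j \<in> {1..d} \<Longrightarrow> x \<in> S \<Longrightarrow> cl M j x \<in> S"
    using assms by (auto simp: clifford_submodule_def subspace_def)
qed

lemma clifford_submodule_composite:
  assumes "hilb V0" "hilb V1" "hilb V2"
    and L01: "clifford_submodule d (hilbert_sum (parity_flip V0) V1) L01"
    and L12: "clifford_submodule d (hilbert_sum (parity_flip V1) V2) L12"
  shows "clifford_submodule d (hilbert_sum (parity_flip V0) V2)
    {(a, c). \<exists>b. (a, b) \<in> L01 \<and> (b, c) \<in> L12}"
proof -
  have vs: "vector_space (scl (hilbert_sum (parity_flip V) W))" if "hilb V" "hilb W"
    for V :: "('k::real_or_complex, 'x::{real_inner, complete_space}) cl_hilbert"
      and W :: "('k, 'y::{real_inner, complete_space}) cl_hilbert"
    using hilb_hilbert_sum[OF hilb_parity_flip[OF that(1)] that(2)]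
    unfolding hilb_def hilbert_space_def by blast
  note D = clifford_submoduleD[OF vs[OF assms(1,2)] L01] clifford_submoduleD[OF vs[OF assms(2,3)] L12]
  show ?thesis
  proof (rule clifford_submoduleI[OF vs[OF assms(1,3)]])
    show "0 \<in> {(a, c). \<exists>b. (a, b) \<in> L01 \<and> (b, c) \<in> L12}"
      using D(1,5) by (auto simp: zero_prod_def)
    fix x assume "x \<in> {(a, c). \<exists>b. (a, b) \<in> L01 \<and> (b, c) \<in> L12}"
    then obtain a b c where x: "x = (a, c)" "(a, b) \<in> L01" "(b, c) \<in> L12" by auto
    show "scl (hilbert_sum (parity_flip V0) V2) k x \<in> {(a, c). \<exists>b. (a, b) \<in> L01 \<and> (b, c) \<in> L12}" for k
      using D(3)[OF x(2), of k] D(7)[OF x(3), of k] x by auto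
    show "cl (hilbert_sum (parity_flip V0) V2) j x \<in> {(a, c). \<exists>b. (a, b) \<in> L01 \<and> (b, c) \<in> L12}"
      if "j \<in> {1..d}" for j
      using D(4)[OF that x(2)] D(8)[OF that x(3)] x by auto
    fix y assume "y \<in> {(a, c). \<exists>b. (a, b) \<in> L01 \<and> (b, c) \<in> L12}"
    then obtain a' b' c' where y: "y = (a', c')" "(a', b') \<in> L01" "(b', c') \<in> L12" by auto
    show "x + y \<in> {(a, c). \<exists>b. (a, b) \<in> L01 \<and> (b, c) \<in> L12}"
      using D(2)[OF x(2) y(2)] D(6)[OF x(3) y(3)] x y by auto
  qed
qed

text \<open>The kernel of the composed map is an extension: \<open>r\<close> on first components
  maps it onto the span of \<open>B\<close>, and what goes to 0 is the product of the two given
  kernels.\<close>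

lemma finite_dimensional_fiber_kernel:
  fixes M :: "('k::field, 'g::ab_group_add) cl_space" and N :: "('k, 'h::ab_group_add) cl_space"
    and t :: "'k \<Rightarrow> 'b::ab_group_add \<Rightarrow> 'b"
  assumes "vector_space (scl M)" "vector_space (scl N)" "vector_space t"
    and K: "module.subspace (\<lambda>c. map_prod (scl M c) (scl N c)) K"
    and add: "\<And>x y. x \<in> K \<Longrightarrow> y \<in> K \<Longrightarrow> r (fst x + fst y) = r (fst x) + r (fst y)"
    and scale: "\<And>c x. x \<in> K \<Longrightarrow> r (scl M c (fst x)) = t c (r (fst x))"
    and B: "finite B" "module.span t B = r ` fst ` K"
    and A: "finite_dimensional M A" "finite_dimensional N C" and AC: "A \<times> C = {x \<in> K. r (fst x) = 0}"
  shows "finite_dimensional (clifford_module_sum M N) K"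
proof -
  interpret M: vector_space "scl M" by fact
  interpret N: vector_space "scl N" by fact
  obtain F G where F: "finite F" "M.span F = A" and G: "finite G" "N.span G = C"
    using A by (auto simp: finite_dimensional_def)
  have "F \<times> {0} \<union> {0} \<times> G \<subseteq> A \<times> C"
    using F G M.span_superset[of F] N.span_superset[of G] M.span_zero[of F] N.span_zero[of G] by auto
  then have sub: "F \<times> {0} \<union> {0} \<times> G \<subseteq> K" using AC by blast
  have "\<exists>F. finite F \<and> module.span (\<lambda>c. map_prod (scl M c) (scl N c)) F = K"
  proof (rule finite_span_extension[where T = "\<lambda>x. r (fst x)" and t = t and B = B
        and F = "F \<times> {0} \<union> {0} \<times> G"])
    show "vector_space (\<lambda>c. map_prod (scl M c) (scl N c))"
      by (rule vector_space_map_prod[OF assms(1,2)])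
    show "module.span t B = (\<lambda>x. r (fst x)) ` K" using B(2) by (simp add: image_image)
    show "{x \<in> K. r (fst x) = 0} \<subseteq> module.span (\<lambda>c. map_prod (scl M c) (scl N c)) (F \<times> {0} \<union> {0} \<times> G)"
      using span_map_prod(2)[OF assms(1,2), of F G] F(2) G(2) AC by simp
    show "r (fst (x + y)) = r (fst x) + r (fst y)" if "x \<in> K" "y \<in> K" for x y
      using add[OF that] by simp
    show "r (fst (map_prod (scl M c) (scl N c) x)) = t c (r (fst x))" if "x \<in> K" for c x
      using scale[OF that] by simp
  qed (use assms(3) K B F G sub in auto)
  then show ?thesis by (simp add: finite_dimensional_def clifford_module_sum_def)
qed

theorem proposition3p20:
  fixes d :: nat
    and V0 :: "('k::real_or_complex, 'a::{real_inner, complete_space}) cl_hilbert"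
    and V1 :: "('k, 'b::{real_inner, complete_space}) cl_hilbert"
    and V2 :: "('k, 'c::{real_inner, complete_space}) cl_hilbert"
    and P0 :: "'a set set" and P1 :: "'b set set" and P2 :: "'c set set"
    and M01 :: "('k, 'g::ab_group_add) cl_space" and H01 :: "'g set"
    and M12 :: "('k, 'h::ab_group_add) cl_space" and H12 :: "'h set"
    and r0 :: "'g \<Rightarrow> 'a" and r1 :: "'g \<Rightarrow> 'b" and r1' :: "'h \<Rightarrow> 'b" and r2 :: "'h \<Rightarrow> 'c"
  assumes "polarized_hilbert_space d V0 P0"
    and "polarized_hilbert_space d V1 P1"
    and "polarized_hilbert_space d V2 P2"
    and "generalized_lagrangian d (hilbert_sum (parity_flip V0) V1) M01 H01 (\<lambda>x. (r0 x, r1 x))"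
    and "split_lagrangian d V0 P0 V1 P1 ((\<lambda>x. (r0 x, r1 x)) ` H01)"
    and "generalized_lagrangian d (hilbert_sum (parity_flip V1) V2) M12 H12 (\<lambda>x. (r1' x, r2 x))"
    and "split_lagrangian d V1 P1 V2 P2 ((\<lambda>x. (r1' x, r2 x)) ` H12)"
  shows "generalized_lagrangian d (hilbert_sum (parity_flip V0) V2)
           (clifford_module_sum M01 M12) (fiber_product H01 H12 r1 r1')
           (\<lambda>(x, y). (r0 x, r2 y)) \<and>
         split_lagrangian d V0 P0 V2 P2
           ((\<lambda>(x, y). (r0 x, r2 y)) ` fiber_product H01 H12 r1 r1')"
proof -
  interpret V0: super_hilb V0 by (rule super_hilb[OF assms(1)])
  interpret V1: super_hilb V1 by (rule super_hilb[OF assms(2)])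
  interpret V2: super_hilb V2 by (rule super_hilb[OF assms(3)])
  interpret X: hilb "hilbert_sum (parity_flip V0) V2"
    by (intro hilb_hilbert_sum hilb_parity_flip V0.hilb_axioms V2.hilb_axioms)
  have P: "polarization d V0 P0" "polarization d V1 P1" "polarization d V2 P2"
    using assms(1-3) by (auto simp: polarized_hilbert_space_def)
  define L01 where "L01 = (\<lambda>x. (r0 x, r1 x)) ` H01"
  define L12 where "L12 = (\<lambda>x. (r1' x, r2 x)) ` H12"
  define FP where "FP = fiber_product H01 H12 r1 r1'"
  define R where "R = (\<lambda>(x, y). (r0 x, r2 y))"
  obtain A0 A1 where A0: "A0 \<in> P0" and A1: "A1 \<in> P1"
    and close01: "close (hilbert_sum (parity_flip V0) V1) L01 (ortho_compl V0 A0 \<times> A1)"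
    and lag01: "lagrangian d (hilbert_sum (parity_flip V0) V1) L01"
    using assms(5) by (auto simp: split_lagrangian_def L01_def)
  obtain A1' A2 where A1': "A1' \<in> P1" and A2: "A2 \<in> P2"
    and close12: "close (hilbert_sum (parity_flip V1) V2) L12 (ortho_compl V1 A1' \<times> A2)"
    and lag12: "lagrangian d (hilbert_sum (parity_flip V1) V2) L12"
    using assms(7) by (auto simp: split_lagrangian_def L12_def)
  note sub = V0.polarization(1)[OF P(1) A0] V1.polarization(1)[OF P(2) A1]
    V1.polarization(1)[OF P(2) A1'] V2.polarization(1)[OF P(3) A2]
  have cs: "closed_subspace V0 A0" "closed_subspace V1 A1" "closed_subspace V1 A1'" "closed_subspace V2 A2"
    using sub by (auto simp: sub_lagrangian_def)
  have L01: "clifford_submodule d (hilbert_sum (parity_flip V0) V1) L01"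
      "lagrangian_pair (grading V0) (grading V1) L01"
    and L12: "clifford_submodule d (hilbert_sum (parity_flip V1) V2) L12"
      "lagrangian_pair (grading V1) (grading V2) L12"
    using lag01 lag12 lagrangian_sum_iff V0.super_hilb_axioms V1.super_hilb_axioms V2.super_hilb_axioms
    by metis+
  interpret composable "grading V0" "grading V1" "grading V2" L01 L12 A0 A1 A1' A2
    by (intro composable.intro composable_axioms.intro L01 L12 V0.closed_sub V1.closed_sub V2.closed_sub cs
        close_sum_hs_on[OF V0.hilb_axioms V1.hilb_axioms close01]
        close_sum_hs_on[OF V1.hilb_axioms V2.hilb_axioms close12]
        V1.polarization(3)[OF P(2) A1 A1'] V0.sub_lagrangian_hs_on[OF sub(1)]
        V2.sub_lagrangian_isotropic[OF sub(4)])
  have image: "R ` FP = composite"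
  proof (intro set_eqI iffI)
    fix z assume "z \<in> R ` FP"
    then show "z \<in> composite"
      unfolding composite_def by (auto simp: R_def FP_def fiber_product_def L01_def L12_def)
  next
    fix z assume "z \<in> composite"
    then obtain x y where "x \<in> H01" "y \<in> H12" "r1 x = r1' y" "z = (r0 x, r2 y)"
      unfolding composite_def by (auto simp: L01_def L12_def)
    then have "(x, y) \<in> FP" "z = R (x, y)" by (auto simp: R_def FP_def fiber_product_def)
    then show "z \<in> R ` FP" by blast
  qed
  have sm: "clifford_submodule d (hilbert_sum (parity_flip V0) V2) composite"
    unfolding composite_def
    by (rule clifford_submodule_composite[OF V0.hilb_axioms V1.hilb_axioms V2.hilb_axioms L01(1) L12(1)])
  then have csC: "closed_subspace (hilbert_sum (parity_flip V0) V2) composite"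
    using C.closed by (simp add: closed_subspace_def clifford_submodule_def)
  have "G ` composite = {(- grading V0 a, grading V2 b) | a b. (a, b) \<in> composite}"
    by (force simp: G_def)
  then have "lagrangian_pair (grading V0) (grading V2) composite"
    using orthogonal_comp_composite C.closed_sub_axioms V0.reflection_grading V2.reflection_grading
    by (simp add: lagrangian_pair_def lagrangian_pair_axioms_def)
  then have lag: "lagrangian d (hilbert_sum (parity_flip V0) V2) composite"
    using lagrangian_sum_iff V0.super_hilb_axioms V2.super_hilb_axioms sm csC by blast
  have "split_lagrangian d V0 P0 V2 P2 composite"
  proof -
    \<comment> \<open>The Hilbert--Schmidt condition on the sum asks for an orthonormal basis; it is
      assembled from those hidden in the polarizations of the summands.\<close>
    obtain E F where EF: "orthonormal_basis V0 E" "orthonormal_basis V2 F"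
      using V0.polarization(2)[OF P(1) A0] V2.polarization(2)[OF P(3) A2] by blast
    have oc: "ortho_compl V0 A0 = orthogonal_comp A0"
      using V0.ortho_compl cs(1) by (simp add: closed_subspace_def)
    have "closed_subspace (hilbert_sum (parity_flip V0) V2) (ortho_compl V0 A0 \<times> A2)"
      using V0.subspace_ortho_compl[of A0] cs(4) closed_orthogonal_comp[of A0]
      by (auto simp: closed_subspace_def oc closed_Times X.vs.subspace_def V0.vs.subspace_def
          V2.vs.subspace_def zero_prod_def)
    then have "close (hilbert_sum (parity_flip V0) V2) composite (ortho_compl V0 A0 \<times> A2)"
      using X.hs_on_close[OF csC _ _ orthonormal_basis_sum[OF V0.hilb_axioms V2.hilb_axioms EF]]
        hs_composite by (simp add: oc)
    then show ?thesis using lag A0 A2 by (auto simp: split_lagrangian_def)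
  qed
  moreover have "generalized_lagrangian d (hilbert_sum (parity_flip V0) V2) (clifford_module_sum M01 M12) FP R"
  proof -
    have M: "clifford_module d M01" "clifford_module d M12"
      and H: "clifford_submodule d M01 H01" "clifford_submodule d M12 H12"
      using assms(4,6) by (auto simp: generalized_lagrangian_def)
    then have vs: "vector_space (scl M01)" "vector_space (scl M12)" by (auto simp: clifford_module_def)
    note H01 = clifford_submoduleD[OF vs(1) H(1)] and H12 = clifford_submoduleD[OF vs(2) H(2)]
    have r01: "\<And>x y. x \<in> H01 \<Longrightarrow> y \<in> H01 \<Longrightarrow> r0 (x + y) = r0 x + r0 y \<and> r1 (x + y) = r1 x + r1 y"
        "\<And>c x. x \<in> H01 \<Longrightarrow> r0 (scl M01 c x) = scl V0 c (r0 x) \<and> r1 (scl M01 c x) = scl V1 c (r1 x)"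
        "\<And>j x. j \<in> {1..d} \<Longrightarrow> x \<in> H01 \<Longrightarrow> r0 (cl M01 j x) = cl V0 j (r0 x) \<and> r1 (cl M01 j x) = cl V1 j (r1 x)"
      and ker01: "finite_dimensional M01 {x \<in> H01. (r0 x, r1 x) = 0}"
      using assms(4) by (auto simp: generalized_lagrangian_def)
    have r12: "\<And>x y. x \<in> H12 \<Longrightarrow> y \<in> H12 \<Longrightarrow> r1' (x + y) = r1' x + r1' y \<and> r2 (x + y) = r2 x + r2 y"
        "\<And>c x. x \<in> H12 \<Longrightarrow> r1' (scl M12 c x) = scl V1 c (r1' x) \<and> r2 (scl M12 c x) = scl V2 c (r2 x)"
        "\<And>j x. j \<in> {1..d} \<Longrightarrow> x \<in> H12 \<Longrightarrow> r1' (cl M12 j x) = cl V1 j (r1' x) \<and> r2 (cl M12 j x) = cl V2 j (r2 x)"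
      and ker12: "finite_dimensional M12 {x \<in> H12. (r1' x, r2 x) = 0}"
      using assms(6) by (auto simp: generalized_lagrangian_def)
    have FP_iff: "(x, y) \<in> FP \<longleftrightarrow> x \<in> H01 \<and> y \<in> H12 \<and> r1 x = r1' y" for x y
      by (simp add: FP_def fiber_product_def)
    have scl_sum: "scl (clifford_module_sum M01 M12) c (x, y) = (scl M01 c x, scl M12 c y)"
      and cl_sum: "cl (clifford_module_sum M01 M12) j (x, y) = (cl M01 j x, cl M12 j y)" for c j x y
      by (simp_all add: clifford_module_sum_def)
    have CM: "clifford_module d (clifford_module_sum M01 M12)" by (rule clifford_module_sum[OF M])
    then have vsM: "vector_space (scl (clifford_module_sum M01 M12))" by (simp add: clifford_module_def)
    have zero: "r0 0 = 0" "r1 0 = 0" "r1' 0 = 0" "r2 0 = 0"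
      using r01(1)[OF H01(1) H01(1)] r12(1)[OF H12(1) H12(1)] by simp_all
    have FPs: "clifford_submodule d (clifford_module_sum M01 M12) FP"
      by (rule clifford_submoduleI[OF vsM])
         (auto simp: zero_prod_def FP_iff scl_sum cl_sum zero H01 H12 r01 r12)
    have radd: "R (x + y) = R x + R y" if "x \<in> FP" "y \<in> FP" for x y
      using that by (cases x; cases y) (auto simp: R_def FP_iff r01 r12)
    have rscl: "R (scl (clifford_module_sum M01 M12) c x) = scl (hilbert_sum (parity_flip V0) V2) c (R x)"
      if "x \<in> FP" for c x
      using that by (cases x) (auto simp: R_def FP_iff r01 r12 scl_sum)
    have rcl: "R (cl (clifford_module_sum M01 M12) j x) = cl (hilbert_sum (parity_flip V0) V2) j (R x)"
      if "j \<in> {1..d}" "x \<in> FP" for j x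
      using that by (cases x) (auto simp: R_def FP_iff r01 r12 cl_sum)
    define K where "K = {x \<in> FP. R x = 0}"
    have K_iff: "(x, y) \<in> K \<longleftrightarrow> x \<in> H01 \<and> y \<in> H12 \<and> r1 x = r1' y \<and> r0 x = 0 \<and> r2 y = 0" for x y
      by (auto simp: K_def FP_iff R_def zero_prod_def)
    \<comment> \<open>The middle vectors joining 0 to 0; they account for the kernel beyond the
      product of the two given kernels.\<close>
    define N where "N = {b. (0, b) \<in> L01 \<and> (b, 0) \<in> L12}"
    have N: "r1 ` fst ` K = N"
    proof (intro set_eqI iffI)
      fix b assume "b \<in> N"
      then obtain x y where "x \<in> H01" "y \<in> H12" "r0 x = 0" "r1 x = b" "r1' y = b" "r2 y = 0"
        by (auto simp: N_def L01_def L12_def)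
      then have "(x, y) \<in> K" "b = r1 (fst (x, y))" by (auto simp: K_iff)
      then show "b \<in> r1 ` fst ` K" by blast
    next
      fix b assume "b \<in> r1 ` fst ` K"
      then obtain x y where "(x, y) \<in> K" "b = r1 x" by auto
      then show "b \<in> N" by (auto simp: K_iff N_def L01_def L12_def image_iff)
    qed
    have subK: "module.subspace (\<lambda>c. map_prod (scl M01 c) (scl M12 c)) K"
    proof -
      interpret p: vector_space "\<lambda>c. map_prod (scl M01 c) (scl M12 c)"
        by (rule vector_space_map_prod[OF vs])
      show ?thesis
        by (rule p.subspaceI)
           (auto simp: zero_prod_def K_iff zero H01 H12 r01 r12)
    qed
    obtain B where B: "finite B" "span B = N" using finite_fiber unfolding N_def by blast
    have NI: "r1 x \<in> N" if "(x, y) \<in> K" for x y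
      unfolding N[symmetric] by (rule image_eqI[OF _ imageI[OF that]]) simp
    \<comment> \<open>\<open>finite_fiber\<close> gives a real spanning set; stability of
      \<open>N\<close> under all scalars turns it into a spanning set over the field.\<close>
    have "V1.vs.subspace N"
    proof (rule V1.vs.subspaceI)
      have "(0, 0) \<in> K" by (simp add: K_iff zero H01 H12)
      from NI[OF this] show "0 \<in> N" by (simp add: zero)
      fix b assume "b \<in> N"
      then obtain x y where x: "(x, y) \<in> K" "b = r1 x" unfolding N[symmetric] by auto
      then have "(scl M01 c x, scl M12 c y) \<in> K" for c by (simp add: K_iff H01 H12 r01 r12)
      from NI[OF this] show "scl V1 c b \<in> N" for c
        using x by (simp add: K_iff r01)
      fix b' assume "b' \<in> N"
      then obtain x' y' where x': "(x', y') \<in> K" "b' = r1 x'" unfolding N[symmetric] by auto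
      then have "(x + x', y + y') \<in> K" using x by (simp add: K_iff H01 H12 r01 r12)
      from NI[OF this] show "b + b' \<in> N"
        using x x' by (simp add: K_iff r01)
    qed
    have "finite_dimensional (clifford_module_sum M01 M12) K"
    proof (rule finite_dimensional_fiber_kernel[OF vs V1.vs.vector_space_axioms subK])
      show "finite B" by (rule B(1))
      show "V1.vs.span B = r1 ` fst ` K"
        unfolding N by (rule V1.finite_dim_real[OF \<open>V1.vs.subspace N\<close> B(2)])
      show "{x \<in> H01. (r0 x, r1 x) = 0} \<times> {x \<in> H12. (r1' x, r2 x) = 0} = {x \<in> K. r1 (fst x) = 0}"
        by (auto simp: K_iff zero_prod_def)
    qed (use ker01 ker12 in \<open>auto simp: K_iff r01\<close>)
    then show ?thesis
      using CM FPs radd rscl rcl lag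
      unfolding generalized_lagrangian_def image K_def by blast
  qed
  ultimately show ?thesis using image by (simp add: FP_def R_def)
qed

end
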